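(* Let $m_1,\ldots,m_\ell$ be positive integers and $m:=\sum_{i=1}^\ell m_i$. Let $S_i\subset\mathbb{R}^{n_i}$ be an $n_i$-dimensional $m_i$-brick for $i=1,\ldots,\ell$ and denote $n:=\sum_{i=1}^\ell n_i$. Then the product $S:=\prod_{i=1}^\ell S_i\subset\mathbb{R}^n$ has dimension $n$ and it is an $m$-brick.
   Context: $\overline{B}_m$ denotes the closed unit ball of $\mathbb{R}^m$ centered at the origin. An $n$-dimensional semialgebraic set $T\subset\mathbb{R}^n$ is an $m$-brick if there exists a homotopy $H=(H_1,\ldots,H_n):[0,1]\times\overline{B}_m\to T$ such that: (1) each $H_i$ is the restriction to $[0,1]\times\overline{B}_m$ of a polynomial of the ring $\mathcal{C}^0([0,1])[x_1,\ldots,x_m]$, where $\mathcal{C}^0([0,1])$ is the ring of continuous real functions on $[0,1]$; (2) $H(\{0\}\times\overline{B}_m)=T$ and $H(1,\cdot)$ is a constant map; (3) $H(\{t\}\times\overline{B}_m)\subset\operatorname{Int}(T)$ for each $t\in(0,1)$, where $\operatorname{Int}$ is the topological interior in $\mathbb{R}^n$. *)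

theory Defs
  imports "HOL-Analysis.Analysis" "HOL-Algebra.Ideal"
begin

text \<open>
  Since the number of factors and their dimensions vary inside the statement, \<open>\<real>\<^sup>n\<close> is the space
  \<^const>\<open>Euclidean_space\<close> \<open>n\<close>, whose points are the functions \<open>nat \<Rightarrow> real\<close> that vanish at all
  indices \<open>\<ge> n\<close>. Coordinates are numbered \<open>0, \<dots>, n - 1\<close>.
\<close>

definition closed_unit_ball :: "nat \<Rightarrow> (nat \<Rightarrow> real) set" where
  "closed_unit_ball m = {x \<in> topspace (Euclidean_space m). (\<Sum>i<m. (x i)\<^sup>2) \<le> 1}"

text \<open>
  The monomial \<open>x\<^sub>0^\<alpha>\<^sub>0 \<cdots> x\<^sub>n\<^sub>-\<^sub>1^\<alpha>\<^sub>n\<^sub>-\<^sub>1\<close>. The values of \<open>\<alpha>\<close> at indices \<open>\<ge> n\<close> are ignored, so in a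
  sum of monomials a power product may occur repeatedly; this does not change which functions are
  polynomial.
\<close>
definition monomial :: "nat \<Rightarrow> (nat \<Rightarrow> nat) \<Rightarrow> (nat \<Rightarrow> real) \<Rightarrow> real" where
  "monomial n \<alpha> x = (\<Prod>i<n. x i ^ \<alpha> i)"

definition polynomial_fun :: "nat \<Rightarrow> ((nat \<Rightarrow> real) \<Rightarrow> real) \<Rightarrow> bool" where
  "polynomial_fun n p \<longleftrightarrow>
     (\<exists>A c. finite A \<and> (\<forall>x. p x = (\<Sum>\<alpha>\<in>A. c \<alpha> * monomial n \<alpha> x)))"

text \<open>
  \<open>h\<close> is the restriction to \<open>[0,1] \<times> X\<close> of a polynomial in \<open>m\<close> variables over the ring of continuous
  real functions on \<open>[0,1]\<close>.
\<close>
definition polynomial_over_C0 ::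
  "nat \<Rightarrow> (nat \<Rightarrow> real) set \<Rightarrow> (real \<times> (nat \<Rightarrow> real) \<Rightarrow> real) \<Rightarrow> bool" where
  "polynomial_over_C0 m X h \<longleftrightarrow>
     (\<exists>A c. finite A \<and> (\<forall>\<alpha>\<in>A. continuous_on {0..1} (c \<alpha>)) \<and>
        (\<forall>t\<in>{0..1}. \<forall>x\<in>X. h (t, x) = (\<Sum>\<alpha>\<in>A. c \<alpha> t * monomial m \<alpha> x)))"

inductive semialgebraic :: "nat \<Rightarrow> (nat \<Rightarrow> real) set \<Rightarrow> bool" for n where
  positive: "polynomial_fun n p \<Longrightarrow> semialgebraic n {x \<in> topspace (Euclidean_space n). p x > 0}"
| union: "semialgebraic n S \<Longrightarrow> semialgebraic n T \<Longrightarrow> semialgebraic n (S \<union> T)"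
| intersection: "semialgebraic n S \<Longrightarrow> semialgebraic n T \<Longrightarrow> semialgebraic n (S \<inter> T)"
| complement: "semialgebraic n S \<Longrightarrow> semialgebraic n (topspace (Euclidean_space n) - S)"

text \<open>
  The dimension of a semialgebraic set \<open>S \<subseteq> \<real>\<^sup>n\<close> is, as in Bochnak, Coste and Roy, the Krull dimension
  of \<open>\<real>[x\<^sub>0, \<dots>, x\<^sub>n\<^sub>-\<^sub>1] / I(S)\<close>, where \<open>I(S)\<close> is the ideal of the polynomials vanishing on \<open>S\<close>.
  This quotient is realised as the ring of polynomial functions on \<open>S\<close>.
\<close>
definition polynomial_fun_ring :: "nat \<Rightarrow> (nat \<Rightarrow> real) set \<Rightarrow> ((nat \<Rightarrow> real) \<Rightarrow> real) ring" where
  "polynomial_fun_ring n S =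
     \<lparr>carrier = {restrict p S |p. polynomial_fun n p},
      mult = (\<lambda>f g. \<lambda>x\<in>S. f x * g x),
      one = (\<lambda>x\<in>S. 1),
      zero = (\<lambda>x\<in>S. 0),
      add = (\<lambda>f g. \<lambda>x\<in>S. f x + g x)\<rparr>"

definition prime_chain :: "('a, 'b) ring_scheme \<Rightarrow> nat \<Rightarrow> (nat \<Rightarrow> 'a set) \<Rightarrow> bool" where
  "prime_chain R k P \<longleftrightarrow> (\<forall>i\<le>k. primeideal (P i) R) \<and> (\<forall>i<k. P i \<subset> P (Suc i))"

text \<open>The value is \<open>-\<infinity>\<close> if \<open>R\<close> has no prime ideal, i.e. for the zero ring.\<close>
definition krull_dim :: "('a, 'b) ring_scheme \<Rightarrow> ereal" where
  "krull_dim R = (SUP k \<in> {k. \<exists>P. prime_chain R k P}. ereal (real k))"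

definition semialgebraic_dim :: "nat \<Rightarrow> (nat \<Rightarrow> real) set \<Rightarrow> ereal" where
  "semialgebraic_dim n S = krull_dim (polynomial_fun_ring n S)"

text \<open>\<open>T\<close> is an \<open>n\<close>-dimensional \<open>m\<close>-brick in \<open>\<real>\<^sup>n\<close>.\<close>
definition brick :: "nat \<Rightarrow> nat \<Rightarrow> (nat \<Rightarrow> real) set \<Rightarrow> bool" where
  "brick m n T \<longleftrightarrow>
     semialgebraic n T \<and> semialgebraic_dim n T = ereal (real n) \<and>
     (\<exists>H :: real \<times> (nat \<Rightarrow> real) \<Rightarrow> nat \<Rightarrow> real.
        continuous_map
          (prod_topology (top_of_set {0..1}) (subtopology (Euclidean_space m) (closed_unit_ball m)))
          (subtopology (Euclidean_space n) T) H \<and>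
        (\<forall>i<n. polynomial_over_C0 m (closed_unit_ball m) (\<lambda>z. H z i)) \<and>
        H ` ({0} \<times> closed_unit_ball m) = T \<and>
        (\<exists>a. \<forall>x\<in>closed_unit_ball m. H (1, x) = a) \<and>
        (\<forall>t\<in>{0<..<1}. H ` ({t} \<times> closed_unit_ball m) \<subseteq> Euclidean_space n interior_of T))"

text \<open>
  The product of sets \<open>S i \<subseteq> \<real>^(n i)\<close> as a subset of \<open>\<real>^(n 0 + \<dots> + n (l - 1))\<close>, a point of the latter
  being the concatenation of its blocks.
\<close>
definition block :: "(nat \<Rightarrow> nat) \<Rightarrow> nat \<Rightarrow> (nat \<Rightarrow> real) \<Rightarrow> nat \<Rightarrow> real" where
  "block n i x = (\<lambda>j. if j < n i then x ((\<Sum>k<i. n k) + j) else 0)"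

definition block_product :: "(nat \<Rightarrow> nat) \<Rightarrow> nat \<Rightarrow> (nat \<Rightarrow> (nat \<Rightarrow> real) set) \<Rightarrow> (nat \<Rightarrow> real) set" where
  "block_product n l S =
     {x \<in> topspace (Euclidean_space (\<Sum>i<l. n i)). \<forall>i<l. block n i x \<in> S i}"

end

theory Submission
  imports Defs "HOL-Library.Function_Algebras"
begin

text \<open>
  The homotopies \<open>H i\<close> of the factors are combined blockwise, but a product of balls is not a ball:
  the new homotopy has to be defined on the ball of dimension \<open>m 0 + \<dots> + m (l - 1)\<close>. So it is
  composed with a polynomial map \<open>F\<close> from this ball onto the product of the balls of dimensions
  \<open>m i\<close>, and the homotopy of the product is \<open>(t, x) \<mapsto> (H i (t, F i x))\<^sub>i\<close>. The map \<open>F\<close> comes from the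
  radial map \<open>x \<mapsto> x (3 - 4 \<bar>x\<bar>\<^sup>2)\<close>, which maps the unit ball into itself and maps the ball of radius
  \<open>1/2\<close> onto the unit ball. Its \<open>l\<close>-th iterate is a polynomial self-map of the unit ball under which
  every point has a preimage of norm at most \<open>2\<^sup>-\<^sup>l\<close>. Points chosen in this way in the \<open>l\<close> factors fit
  together to a point of norm at most \<open>\<surd>l 2\<^sup>-\<^sup>l \<le> 1\<close>, so applying the iterate to every block is
  surjective (\<open>folded_blocks_onto_product_of_balls\<close>). The conditions on the interior and on the end
  of the homotopy are then inherited from the factors.

  For the dimension, the homotopy at time \<open>1/2\<close> shows that the product has an interior point, and a
  subset of \<open>\<real>\<^sup>n\<close> with an interior point has dimension \<open>n\<close> (\<open>semialgebraic_dim_of_interior\<close>). This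
  is the statement that the ring of polynomial functions on such a set has Krull dimension \<open>n\<close>.

  The lower bound uses the prime ideals of the polynomials that vanish on the slices
  \<open>x\<^sub>0 = a\<^sub>0, \<dots>, x\<^sub>k\<^sub>-\<^sub>1 = a\<^sub>k\<^sub>-\<^sub>1\<close> of a box around an interior point \<open>a\<close>. The upper bound follows the elementary
  argument of Coquand and Lombardi: in a chain of primes of length \<open>k > n\<close>, choose for each step a
  polynomial that lies in the upper but not in the lower prime. These \<open>k\<close> polynomials in \<open>n\<close>
  variables are algebraically dependent, by counting monomials, and a nontrivial relation
  between them is incompatible with the chain (\<open>relation_notin_prime_chain\<close>).
\<close>

section \<open>Polynomial functions with continuous coefficients\<close>

lemma monomial_add: "monomial n (\<lambda>i. \<alpha> i + \<beta> i) x = monomial n \<alpha> x * monomial n \<beta> x"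
  by (simp add: monomial_def power_add prod.distrib)

text \<open>
  A criterion that does not ask for distinct exponents: products of polynomials lead to sums indexed
  by pairs in which the same power product occurs several times, and those terms are collected here.
\<close>
lemma polynomial_over_C0I:
  assumes "finite K" "\<And>k. k \<in> K \<Longrightarrow> continuous_on {0..1} (c k)"
    and "\<And>t x. t \<in> {0..1} \<Longrightarrow> x \<in> X \<Longrightarrow> h (t, x) = (\<Sum>k\<in>K. c k t * monomial m (e k) x)"
  shows "polynomial_over_C0 m X h"
proof -
  have "(\<Sum>k\<in>K. c k t * monomial m (e k) x) =
      (\<Sum>\<alpha>\<in>e ` K. (\<Sum>k | k \<in> K \<and> e k = \<alpha>. c k t) * monomial m \<alpha> x)" for t x
    by (subst sum.image_gen[OF \<open>finite K\<close>, where g = e])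
      (simp add: sum_distrib_right)
  moreover have "continuous_on {0..1} (\<lambda>t. \<Sum>k | k \<in> K \<and> e k = \<alpha>. c k t)" for \<alpha>
    using assms(2) by (intro continuous_on_sum) auto
  ultimately show ?thesis
    unfolding polynomial_over_C0_def using assms(1,3)
    by (intro exI[of _ "e ` K"] exI[of _ "\<lambda>\<alpha> t. \<Sum>k | k \<in> K \<and> e k = \<alpha>. c k t"]) auto
qed

lemma polynomial_over_C0_cong:
  assumes "\<And>t x. t \<in> {0..1} \<Longrightarrow> x \<in> X \<Longrightarrow> h (t, x) = k (t, x)"
  shows "polynomial_over_C0 m X h \<longleftrightarrow> polynomial_over_C0 m X k"
  using assms unfolding polynomial_over_C0_def by simp

lemma polynomial_over_C0_coefficient:
  "continuous_on {0..1} c \<Longrightarrow> polynomial_over_C0 m X (\<lambda>z. c (fst z))"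
  by (rule polynomial_over_C0I[where K = "{0}" and c = "\<lambda>_. c" and e = "\<lambda>_ _. 0"])
    (auto simp: monomial_def)

lemma polynomial_over_C0_const: "polynomial_over_C0 m X (\<lambda>z. a)"
  using polynomial_over_C0_coefficient[of "\<lambda>_. a"] by simp

lemma polynomial_over_C0_coordinate:
  assumes "j < m"
  shows "polynomial_over_C0 m X (\<lambda>z. snd z j)"
proof -
  have "monomial m (\<lambda>i. if i = j then 1 else 0) x = x j" for x
  proof -
    have "monomial m (\<lambda>i. if i = j then 1 else 0) x = (\<Prod>i<m. if i = j then x i else 1)"
      unfolding monomial_def by (intro prod.cong) auto
    then show ?thesis
      using assms by simp
  qed
  then show ?thesis
    by (intro polynomial_over_C0I[where K = "{j}" and c = "\<lambda>_ _. 1"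
          and e = "\<lambda>_ i. if i = j then 1 else 0"]) auto
qed

lemma polynomial_over_C0_add:
  assumes "polynomial_over_C0 m X h" "polynomial_over_C0 m X k"
  shows "polynomial_over_C0 m X (\<lambda>z. h z + k z)"
proof -
  obtain A c where A: "finite A" "\<And>\<alpha>. \<alpha> \<in> A \<Longrightarrow> continuous_on {0..1} (c \<alpha>)"
    "\<And>t x. t \<in> {0..1} \<Longrightarrow> x \<in> X \<Longrightarrow> h (t, x) = (\<Sum>\<alpha>\<in>A. c \<alpha> t * monomial m \<alpha> x)"
    using assms(1) unfolding polynomial_over_C0_def by blast
  obtain B d where B: "finite B" "\<And>\<alpha>. \<alpha> \<in> B \<Longrightarrow> continuous_on {0..1} (d \<alpha>)"
    "\<And>t x. t \<in> {0..1} \<Longrightarrow> x \<in> X \<Longrightarrow> k (t, x) = (\<Sum>\<alpha>\<in>B. d \<alpha> t * monomial m \<alpha> x)"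
    using assms(2) unfolding polynomial_over_C0_def by blast
  show ?thesis
    by (rule polynomial_over_C0I[where K = "A <+> B" and c = "case_sum c d" and e = "case_sum id id"])
      (use A B in \<open>auto simp: sum.Plus\<close>)
qed

lemma polynomial_over_C0_mult:
  assumes "polynomial_over_C0 m X h" "polynomial_over_C0 m X k"
  shows "polynomial_over_C0 m X (\<lambda>z. h z * k z)"
proof -
  obtain A c where A: "finite A" "\<And>\<alpha>. \<alpha> \<in> A \<Longrightarrow> continuous_on {0..1} (c \<alpha>)"
    "\<And>t x. t \<in> {0..1} \<Longrightarrow> x \<in> X \<Longrightarrow> h (t, x) = (\<Sum>\<alpha>\<in>A. c \<alpha> t * monomial m \<alpha> x)"
    using assms(1) unfolding polynomial_over_C0_def by blast
  obtain B d where B: "finite B" "\<And>\<alpha>. \<alpha> \<in> B \<Longrightarrow> continuous_on {0..1} (d \<alpha>)"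
    "\<And>t x. t \<in> {0..1} \<Longrightarrow> x \<in> X \<Longrightarrow> k (t, x) = (\<Sum>\<alpha>\<in>B. d \<alpha> t * monomial m \<alpha> x)"
    using assms(2) unfolding polynomial_over_C0_def by blast
  show ?thesis
  proof (rule polynomial_over_C0I[where K = "A \<times> B" and c = "\<lambda>(\<alpha>, \<beta>) t. c \<alpha> t * d \<beta> t"
        and e = "\<lambda>(\<alpha>, \<beta>) i. \<alpha> i + \<beta> i"])
    fix t :: real and x assume "t \<in> {0..1}" "x \<in> X"
    then show "h (t, x) * k (t, x) = (\<Sum>p\<in>A \<times> B. (case p of (\<alpha>, \<beta>) \<Rightarrow> \<lambda>t. c \<alpha> t * d \<beta> t) t *
        monomial m (case p of (\<alpha>, \<beta>) \<Rightarrow> \<lambda>i. \<alpha> i + \<beta> i) x)"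
      by (simp add: A(3) B(3) sum_product sum.cartesian_product monomial_add case_prod_unfold mult_ac)
  qed (use A B in \<open>auto intro!: continuous_intros\<close>)
qed

lemma polynomial_over_C0_sum:
  assumes "\<And>i. i \<in> I \<Longrightarrow> polynomial_over_C0 m X (h i)"
  shows "polynomial_over_C0 m X (\<lambda>z. \<Sum>i\<in>I. h i z)"
  using assms
  by (induction I rule: infinite_finite_induct)
    (auto intro: polynomial_over_C0_add polynomial_over_C0_const)

lemma polynomial_over_C0_prod:
  assumes "\<And>i. i \<in> I \<Longrightarrow> polynomial_over_C0 m X (h i)"
  shows "polynomial_over_C0 m X (\<lambda>z. \<Prod>i\<in>I. h i z)"
  using assms
  by (induction I rule: infinite_finite_induct)
    (auto intro: polynomial_over_C0_mult polynomial_over_C0_const)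

lemma polynomial_over_C0_power:
  "polynomial_over_C0 m X h \<Longrightarrow> polynomial_over_C0 m X (\<lambda>z. h z ^ k)"
  by (induction k) (auto intro: polynomial_over_C0_mult polynomial_over_C0_const)

lemma polynomial_over_C0_compose:
  assumes h: "polynomial_over_C0 m Y h"
    and g: "\<And>j. j < m \<Longrightarrow> polynomial_over_C0 k X (\<lambda>z. g z j)"
    and gY: "\<And>t x. t \<in> {0..1} \<Longrightarrow> x \<in> X \<Longrightarrow> g (t, x) \<in> Y"
  shows "polynomial_over_C0 k X (\<lambda>z. h (fst z, g z))"
proof -
  obtain A c where A: "finite A" "\<And>\<alpha>. \<alpha> \<in> A \<Longrightarrow> continuous_on {0..1} (c \<alpha>)"
    "\<And>t x. t \<in> {0..1} \<Longrightarrow> x \<in> Y \<Longrightarrow> h (t, x) = (\<Sum>\<alpha>\<in>A. c \<alpha> t * monomial m \<alpha> x)"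
    using h unfolding polynomial_over_C0_def by blast
  have "polynomial_over_C0 k X (\<lambda>z. \<Sum>\<alpha>\<in>A. c \<alpha> (fst z) * monomial m \<alpha> (g z))"
    unfolding monomial_def
    by (intro polynomial_over_C0_sum polynomial_over_C0_mult polynomial_over_C0_prod
        polynomial_over_C0_power polynomial_over_C0_coefficient A g) auto
  then show ?thesis
    by (subst polynomial_over_C0_cong[where k = "\<lambda>z. \<Sum>\<alpha>\<in>A. c \<alpha> (fst z) * monomial m \<alpha> (g z)"])
      (simp_all add: A(3) gY)
qed

text \<open>
  Makes the continuity of a homotopy with polynomial coordinates automatic.
\<close>
lemma continuous_map_polynomial_over_C0:
  assumes "polynomial_over_C0 m X h"
  shows "continuous_map (prod_topology (top_of_set {0..1}) (subtopology (Euclidean_space m) X))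
    euclideanreal h"
proof -
  obtain A c where A: "finite A" "\<And>\<alpha>. \<alpha> \<in> A \<Longrightarrow> continuous_on {0..1} (c \<alpha>)"
    "\<And>t x. t \<in> {0..1} \<Longrightarrow> x \<in> X \<Longrightarrow> h (t, x) = (\<Sum>\<alpha>\<in>A. c \<alpha> t * monomial m \<alpha> x)"
    using assms unfolding polynomial_over_C0_def by blast
  let ?T = "prod_topology (top_of_set {0..1::real}) (subtopology (Euclidean_space m) X)"
  have coefficient: "continuous_map ?T euclideanreal (\<lambda>z. c \<alpha> (fst z))" if "\<alpha> \<in> A" for \<alpha>
    using continuous_map_compose[OF continuous_map_fst, of "top_of_set {0..1}" euclideanreal "c \<alpha>"] A(2)[OF that]
    by (simp add: o_def)
  have coordinate: "continuous_map ?T euclideanreal (\<lambda>z. snd z i)" for i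
  proof -
    have "continuous_map (subtopology (Euclidean_space m) X) euclideanreal (\<lambda>x. x i)"
      unfolding Euclidean_space_def
      by (intro continuous_map_from_subtopology continuous_map_product_projection) auto
    from continuous_map_compose[OF continuous_map_snd this] show ?thesis
      by (simp add: o_def)
  qed
  have "continuous_map ?T euclideanreal (\<lambda>z. \<Sum>\<alpha>\<in>A. c \<alpha> (fst z) * monomial m \<alpha> (snd z))"
    unfolding monomial_def
    by (intro continuous_map_sum continuous_map_real_mult continuous_map_prod
        continuous_map_real_pow coefficient coordinate A) auto
  then show ?thesis
    by (rule continuous_map_eq) (auto simp: A(3))
qed

text \<open>
  All closure properties of polynomial functions are specialisations, through this equivalence, of
  those for polynomials with continuous coefficients.
\<close>
lemma polynomial_fun_iff_over_C0:
  "polynomial_fun n p \<longleftrightarrow> polynomial_over_C0 n UNIV (\<lambda>z. p (snd z))"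
proof
  assume "polynomial_fun n p"
  then obtain A c where A: "finite A" "\<And>x. p x = (\<Sum>\<alpha>\<in>A. c \<alpha> * monomial n \<alpha> x)"
    unfolding polynomial_fun_def by blast
  then show "polynomial_over_C0 n UNIV (\<lambda>z. p (snd z))"
    by (intro polynomial_over_C0I[where K = A and c = "\<lambda>\<alpha> _. c \<alpha>" and e = id]) auto
next
  assume "polynomial_over_C0 n UNIV (\<lambda>z. p (snd z))"
  then obtain A c where A: "finite A"
    "\<forall>t\<in>{0..1::real}. \<forall>x\<in>UNIV. p (snd (t, x)) = (\<Sum>\<alpha>\<in>A. c \<alpha> t * monomial n \<alpha> x)"
    unfolding polynomial_over_C0_def by blast
  have "p x = (\<Sum>\<alpha>\<in>A. c \<alpha> 0 * monomial n \<alpha> x)" for x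
    using bspec[OF bspec[OF A(2)], of 0 x] by simp
  with A(1) show "polynomial_fun n p"
    unfolding polynomial_fun_def by (intro exI[of _ A] exI[of _ "\<lambda>\<alpha>. c \<alpha> 0"]) auto
qed

lemma polynomial_over_C0_subset:
  assumes "polynomial_over_C0 m Y h" "X \<subseteq> Y"
  shows "polynomial_over_C0 m X h"
proof -
  obtain A c where "finite A" "\<And>\<alpha>. \<alpha> \<in> A \<Longrightarrow> continuous_on {0..1} (c \<alpha>)"
    "\<And>t x. t \<in> {0..1} \<Longrightarrow> x \<in> Y \<Longrightarrow> h (t, x) = (\<Sum>\<alpha>\<in>A. c \<alpha> t * monomial m \<alpha> x)"
    using assms(1) unfolding polynomial_over_C0_def by blast
  then show ?thesis
    using assms(2) by (intro polynomial_over_C0I[where K = A and c = c and e = "\<lambda>\<alpha>. \<alpha>"]) auto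
qed

lemma polynomial_over_C0_of_polynomial_fun:
  "polynomial_fun n p \<Longrightarrow> polynomial_over_C0 n X (\<lambda>z. p (snd z))"
  using polynomial_over_C0_subset[of n UNIV] by (simp add: polynomial_fun_iff_over_C0)

lemma polynomial_fun_const: "polynomial_fun n (\<lambda>x. a)"
  by (simp add: polynomial_fun_iff_over_C0 polynomial_over_C0_const)

lemma polynomial_fun_coordinate: "j < n \<Longrightarrow> polynomial_fun n (\<lambda>x. x j)"
  by (simp add: polynomial_fun_iff_over_C0 polynomial_over_C0_coordinate)

lemma polynomial_fun_add:
  "polynomial_fun n p \<Longrightarrow> polynomial_fun n q \<Longrightarrow> polynomial_fun n (\<lambda>x. p x + q x)"
  by (simp add: polynomial_fun_iff_over_C0 polynomial_over_C0_add)

lemma polynomial_fun_mult: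
  "polynomial_fun n p \<Longrightarrow> polynomial_fun n q \<Longrightarrow> polynomial_fun n (\<lambda>x. p x * q x)"
  by (simp add: polynomial_fun_iff_over_C0 polynomial_over_C0_mult)

lemma polynomial_fun_sum:
  "(\<And>i. i \<in> I \<Longrightarrow> polynomial_fun n (p i)) \<Longrightarrow> polynomial_fun n (\<lambda>x. \<Sum>i\<in>I. p i x)"
  by (simp add: polynomial_fun_iff_over_C0 polynomial_over_C0_sum)

lemma polynomial_fun_prod:
  "(\<And>i. i \<in> I \<Longrightarrow> polynomial_fun n (p i)) \<Longrightarrow> polynomial_fun n (\<lambda>x. \<Prod>i\<in>I. p i x)"
  by (simp add: polynomial_fun_iff_over_C0 polynomial_over_C0_prod)

lemma polynomial_fun_power: "polynomial_fun n p \<Longrightarrow> polynomial_fun n (\<lambda>x. p x ^ k)"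
  by (simp add: polynomial_fun_iff_over_C0 polynomial_over_C0_power)

lemma polynomial_fun_uminus: "polynomial_fun n p \<Longrightarrow> polynomial_fun n (\<lambda>x. - p x)"
  using polynomial_fun_mult[OF polynomial_fun_const[of n "-1"]] by simp

lemma polynomial_fun_compose:
  assumes "polynomial_fun n p" "\<And>j. j < n \<Longrightarrow> polynomial_fun k (\<lambda>x. g x j)"
  shows "polynomial_fun k (\<lambda>x. p (g x))"
  using polynomial_over_C0_compose[of n UNIV "\<lambda>z. p (snd z)" k UNIV "\<lambda>z. g (snd z)"] assms
  by (simp add: polynomial_fun_iff_over_C0)

lemmas polynomial_fun_intros =
  polynomial_fun_const polynomial_fun_coordinate polynomial_fun_add polynomial_fun_mult
  polynomial_fun_sum polynomial_fun_prod polynomial_fun_power polynomial_fun_uminus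

section \<open>Chains of prime ideals and algebraic relations\<close>

text \<open>
  The preimage of \<open>J\<close> in the full polynomial ring. Working with preimages avoids restricting every
  function that occurs in an algebraic relation to \<open>S\<close>.
\<close>
definition polynomial_ideal ::
  "nat \<Rightarrow> (nat \<Rightarrow> real) set \<Rightarrow> ((nat \<Rightarrow> real) \<Rightarrow> real) set \<Rightarrow> ((nat \<Rightarrow> real) \<Rightarrow> real) set" where
  "polynomial_ideal n S J = {p. polynomial_fun n p \<and> restrict p S \<in> J}"

lemma carrier_polynomial_fun_ring:
  "f \<in> carrier (polynomial_fun_ring n S) \<longleftrightarrow> (\<exists>p. polynomial_fun n p \<and> f = restrict p S)"
  by (auto simp: polynomial_fun_ring_def)

lemma polynomial_fun_ring_simps:
  "restrict p S \<oplus>\<^bsub>polynomial_fun_ring n S\<^esub> restrict q S = restrict (\<lambda>x. p x + q x) S"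
  "restrict p S \<otimes>\<^bsub>polynomial_fun_ring n S\<^esub> restrict q S = restrict (\<lambda>x. p x * q x) S"
  "\<zero>\<^bsub>polynomial_fun_ring n S\<^esub> = restrict (\<lambda>x. 0) S"
  "\<one>\<^bsub>polynomial_fun_ring n S\<^esub> = restrict (\<lambda>x. 1) S"
  by (auto simp: polynomial_fun_ring_def restrict_def)

lemma cring_polynomial_fun_ring: "cring (polynomial_fun_ring n S)"
proof (rule cringI)
  let ?R = "polynomial_fun_ring n S"
  show "abelian_group ?R"
  proof (rule abelian_groupI)
    fix f assume "f \<in> carrier ?R"
    then obtain p where p: "polynomial_fun n p" "f = restrict p S"
      by (auto simp: carrier_polynomial_fun_ring)
    then have "restrict (\<lambda>x. - p x) S \<in> carrier ?R"
      by (auto simp: carrier_polynomial_fun_ring intro: polynomial_fun_intros)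
    then show "\<exists>g\<in>carrier ?R. g \<oplus>\<^bsub>?R\<^esub> f = \<zero>\<^bsub>?R\<^esub>"
      by (rule rev_bexI) (simp add: p polynomial_fun_ring_simps)
  qed (auto simp: carrier_polynomial_fun_ring polynomial_fun_ring_simps add_ac intro: polynomial_fun_intros)
  show "comm_monoid ?R"
    by (rule comm_monoidI)
      (auto simp: carrier_polynomial_fun_ring polynomial_fun_ring_simps mult_ac intro: polynomial_fun_intros)
qed (auto simp: carrier_polynomial_fun_ring polynomial_fun_ring_simps algebra_simps)

lemma
  assumes "primeideal J (polynomial_fun_ring n S)"
  shows polynomial_ideal_add: "\<And>p q. p \<in> polynomial_ideal n S J \<Longrightarrow> q \<in> polynomial_ideal n S J \<Longrightarrow>
      (\<lambda>x. p x + q x) \<in> polynomial_ideal n S J"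
    and polynomial_ideal_mult: "\<And>p q. polynomial_fun n q \<Longrightarrow> p \<in> polynomial_ideal n S J \<Longrightarrow>
      (\<lambda>x. q x * p x) \<in> polynomial_ideal n S J"
    and polynomial_ideal_prime: "\<And>p q. polynomial_fun n p \<Longrightarrow> polynomial_fun n q \<Longrightarrow>
      (\<lambda>x. p x * q x) \<in> polynomial_ideal n S J \<Longrightarrow>
      p \<in> polynomial_ideal n S J \<or> q \<in> polynomial_ideal n S J"
    and polynomial_ideal_one: "(\<lambda>x. 1) \<notin> polynomial_ideal n S J"
proof -
  let ?R = "polynomial_fun_ring n S"
  interpret primeideal J ?R
    by fact
  have carrier: "polynomial_fun n p \<Longrightarrow> restrict p S \<in> carrier ?R" for p
    by (auto simp: carrier_polynomial_fun_ring)
  show "(\<lambda>x. p x + q x) \<in> polynomial_ideal n S J"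
    if "p \<in> polynomial_ideal n S J" "q \<in> polynomial_ideal n S J" for p q
    using that additive_subgroup.a_closed[OF additive_subgroup_axioms, of "restrict p S" "restrict q S"]
    by (simp add: polynomial_ideal_def polynomial_fun_ring_simps polynomial_fun_add)
  show "(\<lambda>x. q x * p x) \<in> polynomial_ideal n S J"
    if "polynomial_fun n q" "p \<in> polynomial_ideal n S J" for p q
    using that I_l_closed[of "restrict p S" "restrict q S"] carrier[of q]
    by (simp add: polynomial_ideal_def polynomial_fun_ring_simps polynomial_fun_mult)
  show "p \<in> polynomial_ideal n S J \<or> q \<in> polynomial_ideal n S J"
    if "polynomial_fun n p" "polynomial_fun n q" "(\<lambda>x. p x * q x) \<in> polynomial_ideal n S J" for p q
    using that I_prime[of "restrict p S" "restrict q S"] carrier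
    by (simp add: polynomial_ideal_def polynomial_fun_ring_simps)
  have "restrict (\<lambda>x. 1) S = \<one>\<^bsub>?R\<^esub>"
    by (simp add: polynomial_fun_ring_simps)
  then show "(\<lambda>x. 1) \<notin> polynomial_ideal n S J"
    using I_notcarr one_imp_carrier by (auto simp: polynomial_ideal_def)
qed

lemma polynomial_ideal_const:
  assumes "primeideal J (polynomial_fun_ring n S)" "a \<noteq> 0"
  shows "(\<lambda>x. a) \<notin> polynomial_ideal n S J"
  using polynomial_ideal_mult[OF assms(1) polynomial_fun_const[of n "1 / a"], of "\<lambda>x. a"] assms(2)
    polynomial_ideal_one[OF assms(1)] by auto

lemma polynomial_ideal_cancel_power:
  assumes J: "primeideal J (polynomial_fun_ring n S)"
    and "polynomial_fun n f" "f \<notin> polynomial_ideal n S J" "polynomial_fun n g"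
    and "(\<lambda>x. f x ^ k * g x) \<in> polynomial_ideal n S J"
  shows "g \<in> polynomial_ideal n S J"
  using assms(5)
proof (induction k)
  case 0
  then show ?case by simp
next
  case (Suc k)
  have "(\<lambda>x. f x * (f x ^ k * g x)) \<in> polynomial_ideal n S J"
    using Suc.prems by (simp add: mult.assoc)
  then have "(\<lambda>x. f x ^ k * g x) \<in> polynomial_ideal n S J"
    using polynomial_ideal_prime[OF J assms(2), of "\<lambda>x. f x ^ k * g x"] assms(2-4)
    by (simp add: polynomial_fun_mult polynomial_fun_power)
  then show ?case
    by (rule Suc.IH)
qed

text \<open>
  The relation is taken apart along its lexicographically smallest exponent. Let \<open>m\<close> be the smallest
  exponent of \<open>f j\<close> that occurs; then the sum is \<open>f j ^ m * (g + f j * h)\<close>, where \<open>g\<close> collects the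
  terms with this exponent and does not involve \<open>f j\<close>. If the sum lay in \<open>P j\<close>, then so would
  \<open>g + f j * h\<close>, because \<open>P j\<close> is prime and does not contain \<open>f j\<close>. But \<open>f j\<close> lies in the next ideal,
  so \<open>g\<close> would, too, and \<open>g\<close> is a relation of the same kind for the rest of the chain. At the end
  of the chain only a nonzero constant is left.

  The injectivity hypothesis says that the exponents in \<open>B\<close> are distinct on the indices that still
  matter, so that no cancellation is hidden in the sum.
\<close>
lemma relation_notin_prime_chain:
  fixes f :: "nat \<Rightarrow> (nat \<Rightarrow> real) \<Rightarrow> real" and c :: "(nat \<Rightarrow> nat) \<Rightarrow> real"
  assumes P: "\<And>i. i \<le> k \<Longrightarrow> primeideal (P i) (polynomial_fun_ring n S)"
    and P_mono: "\<And>i. i < k \<Longrightarrow> P i \<subseteq> P (Suc i)"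
    and f: "\<And>i. i < k \<Longrightarrow> polynomial_fun n (f i)"
    and f_in: "\<And>i. i < k \<Longrightarrow> f i \<in> polynomial_ideal n S (P (Suc i))"
    and f_notin: "\<And>i. i < k \<Longrightarrow> f i \<notin> polynomial_ideal n S (P i)"
    and "j \<le> k" "finite B" "B \<noteq> {}" "\<And>\<beta>. \<beta> \<in> B \<Longrightarrow> c \<beta> \<noteq> 0"
    and "inj_on (\<lambda>\<beta>. restrict \<beta> {j..<k}) B"
  shows "(\<lambda>x. \<Sum>\<beta>\<in>B. c \<beta> * (\<Prod>i=j..<k. f i x ^ \<beta> i)) \<notin> polynomial_ideal n S (P j)"
  using \<open>j \<le> k\<close> assms(7-)
proof (induction j arbitrary: B rule: inc_induct)
  case base
  then obtain \<beta> where "B = {\<beta>}"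
    by (auto simp: inj_on_def)
  then show ?case
    using polynomial_ideal_const[OF P[of k]] base by simp
next
  case (step j)
  let ?I = "\<lambda>j. polynomial_ideal n S (P j)"
  define m where "m = Min ((\<lambda>\<beta>. \<beta> j) ` B)"
  define B' where "B' = {\<beta> \<in> B. \<beta> j = m}"
  have m_le: "m \<le> \<beta> j" if "\<beta> \<in> B" for \<beta>
    using that step.prems(1) by (simp add: m_def)
  have "m \<in> (\<lambda>\<beta>. \<beta> j) ` B"
    unfolding m_def using step.prems by (intro Min_in) auto
  then have "B' \<noteq> {}"
    by (auto simp: B'_def)
  define tail where "tail \<beta> x = (\<Prod>i=Suc j..<k. f i x ^ \<beta> i)" for \<beta> x
  define g where "g x = (\<Sum>\<beta>\<in>B'. c \<beta> * tail \<beta> x)" for x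
  define h where "h x = (\<Sum>\<beta>\<in>B - B'. c \<beta> * (f j x ^ (\<beta> j - Suc m) * tail \<beta> x))" for x
  have tail: "polynomial_fun n (tail \<beta>)" for \<beta>
    unfolding tail_def by (intro polynomial_fun_intros f) auto
  have fj: "polynomial_fun n (f j)"
    using f step.hyps by blast
  have g: "polynomial_fun n g" and h: "polynomial_fun n h"
    unfolding g_def h_def by (intro polynomial_fun_intros tail fj)+
  have split: "(\<Sum>\<beta>\<in>B. c \<beta> * (\<Prod>i=j..<k. f i x ^ \<beta> i)) = f j x ^ m * (g x + f j x * h x)" for x
  proof -
    have "(\<Sum>\<beta>\<in>B. c \<beta> * (\<Prod>i=j..<k. f i x ^ \<beta> i)) = (\<Sum>\<beta>\<in>B. c \<beta> * (f j x ^ \<beta> j * tail \<beta> x))"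
      using step.hyps by (simp add: tail_def prod.atLeast_Suc_lessThan)
    also have "\<dots> = (\<Sum>\<beta>\<in>B - B'. c \<beta> * (f j x ^ \<beta> j * tail \<beta> x)) + (\<Sum>\<beta>\<in>B'. c \<beta> * (f j x ^ \<beta> j * tail \<beta> x))"
      using step.prems(1) by (intro sum.subset_diff) (auto simp: B'_def)
    also have "(\<Sum>\<beta>\<in>B'. c \<beta> * (f j x ^ \<beta> j * tail \<beta> x)) = f j x ^ m * g x"
      by (simp add: g_def B'_def sum_distrib_left mult_ac)
    also have "(\<Sum>\<beta>\<in>B - B'. c \<beta> * (f j x ^ \<beta> j * tail \<beta> x)) = f j x ^ m * (f j x * h x)"
    proof -
      have "f j x ^ \<beta> j = f j x ^ m * (f j x * f j x ^ (\<beta> j - Suc m))" if "\<beta> \<in> B - B'" for \<beta>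
      proof -
        have "\<beta> j = m + Suc (\<beta> j - Suc m)"
          using that m_le[of \<beta>] by (auto simp: B'_def)
        then show ?thesis
          by (metis power_Suc power_add)
      qed
      then show ?thesis
        unfolding h_def sum_distrib_left by (intro sum.cong) auto
    qed
    finally show ?thesis
      by (simp add: algebra_simps)
  qed
  show ?case
  proof
    assume "(\<lambda>x. \<Sum>\<beta>\<in>B. c \<beta> * (\<Prod>i=j..<k. f i x ^ \<beta> i)) \<in> ?I j"
    then have "(\<lambda>x. f j x ^ m * (g x + f j x * h x)) \<in> ?I j"
      by (simp add: split)
    then have "(\<lambda>x. g x + f j x * h x) \<in> ?I j"
      using step.hyps f_notin
      by (intro polynomial_ideal_cancel_power[OF P fj _ polynomial_fun_add[OF g polynomial_fun_mult[OF fj h]]]) auto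
    then have sum_in: "(\<lambda>x. g x + f j x * h x) \<in> ?I (Suc j)"
      using P_mono step.hyps by (auto simp: polynomial_ideal_def)
    have P': "primeideal (P (Suc j)) (polynomial_fun_ring n S)"
      using P step.hyps by simp
    have "(\<lambda>x. (- h x) * f j x) \<in> ?I (Suc j)"
      using polynomial_ideal_mult[OF P' polynomial_fun_uminus[OF h] f_in] step.hyps by blast
    from polynomial_ideal_add[OF P' sum_in this] have "g \<in> ?I (Suc j)"
      by (simp add: algebra_simps)
    moreover have "g \<notin> ?I (Suc j)"
    proof -
      have "inj_on (\<lambda>\<beta>. restrict \<beta> {Suc j..<k}) B'"
      proof (rule inj_onI)
        fix \<beta> \<gamma> assume *: "\<beta> \<in> B'" "\<gamma> \<in> B'" "restrict \<beta> {Suc j..<k} = restrict \<gamma> {Suc j..<k}"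
        have "\<beta> i = \<gamma> i" if "i \<in> {j..<k}" for i
        proof (cases "i = j")
          case False
          then show ?thesis
            using that fun_cong[OF *(3), of i] by simp
        qed (use * in \<open>simp add: B'_def\<close>)
        then have "restrict \<beta> {j..<k} = restrict \<gamma> {j..<k}"
          by (intro restrict_ext)
        then show "\<beta> = \<gamma>"
          using inj_onD[OF step.prems(4), of \<beta> \<gamma>] *(1,2) unfolding B'_def by blast
      qed
      moreover have "g = (\<lambda>x. \<Sum>\<beta>\<in>B'. c \<beta> * (\<Prod>i=Suc j..<k. f i x ^ \<beta> i))"
        by (rule ext) (simp add: g_def tail_def)
      moreover have "finite B'" "\<And>\<beta>. \<beta> \<in> B' \<Longrightarrow> c \<beta> \<noteq> 0"
        using step.prems by (auto simp: B'_def)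
      ultimately show ?thesis
        using step.IH[of B'] \<open>B' \<noteq> {}\<close> by metis
    qed
    ultimately show False
      by contradiction
  qed
qed

section \<open>Algebraic dependence of more than \<open>n\<close> polynomials in \<open>n\<close> variables\<close>

text \<open>
  The algebraic dependence of polynomials is obtained by comparing dimensions in this vector space.
\<close>
interpretation real_fun: vector_space "\<lambda>(c::real) (f :: 'a \<Rightarrow> real) x. c * f x"
  by unfold_locales (auto simp: fun_eq_iff algebra_simps)

lemma sum_fun_apply: "(\<Sum>i\<in>I. f i) x = (\<Sum>i\<in>I. f i x :: real)"
  by (induction I rule: infinite_finite_induct) auto

text \<open>
  Bounding the degree in each variable separately, rather than the total degree, makes the
  monomials easy to count.
\<close>
definition bounded_monomials :: "nat \<Rightarrow> nat \<Rightarrow> ((nat \<Rightarrow> real) \<Rightarrow> real) set" where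
  "bounded_monomials n d = monomial n ` {\<alpha>. \<forall>i<n. \<alpha> i \<le> d}"

lemma bounded_monomials_mono: "d \<le> e \<Longrightarrow> bounded_monomials n d \<subseteq> bounded_monomials n e"
  by (fastforce simp: bounded_monomials_def)

lemma finite_card_bounded_monomials:
  "finite (bounded_monomials n d) \<and> card (bounded_monomials n d) \<le> Suc d ^ n"
proof -
  let ?E = "PiE {..<n} (\<lambda>_. {..d})"
  have "bounded_monomials n d \<subseteq> monomial n ` ?E"
  proof
    fix f assume "f \<in> bounded_monomials n d"
    then obtain \<alpha> where \<alpha>: "f = monomial n \<alpha>" "\<And>i. i < n \<Longrightarrow> \<alpha> i \<le> d"
      by (auto simp: bounded_monomials_def)
    moreover have "monomial n \<alpha> = monomial n (restrict \<alpha> {..<n})"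
      by (auto simp: monomial_def)
    moreover have "restrict \<alpha> {..<n} \<in> ?E"
      using \<alpha>(2) by auto
    ultimately show "f \<in> monomial n ` ?E"
      by blast
  qed
  moreover have "finite ?E"
    by (intro finite_PiE) auto
  moreover have "card ?E = Suc d ^ n"
    by (simp add: card_PiE)
  ultimately show ?thesis
    by (metis card_image_le card_mono finite_imageI finite_subset le_trans)
qed

text \<open>
  Multiplication by a fixed function is linear. Applied to both factors in turn, this reduces products
  of elements of spans to products of monomials.
\<close>
lemma subspace_mult_preimage:
  assumes "real_fun.subspace V"
  shows "real_fun.subspace {f. (\<lambda>x. f x * g x) \<in> V}"
  unfolding real_fun.subspace_def
proof (intro conjI ballI allI)
  show "0 \<in> {f. (\<lambda>x. f x * g x) \<in> V}"
    using real_fun.subspace_0[OF assms] by (simp add: zero_fun_def)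
next
  fix f h assume "f \<in> {f. (\<lambda>x. f x * g x) \<in> V}" "h \<in> {f. (\<lambda>x. f x * g x) \<in> V}"
  then show "f + h \<in> {f. (\<lambda>x. f x * g x) \<in> V}"
    using real_fun.subspace_add[OF assms, of "\<lambda>x. f x * g x" "\<lambda>x. h x * g x"]
    by (simp add: plus_fun_def algebra_simps)
next
  fix c f assume "f \<in> {f. (\<lambda>x. f x * g x) \<in> V}"
  then show "(\<lambda>x. c * f x) \<in> {f. (\<lambda>x. f x * g x) \<in> V}"
    using real_fun.subspace_scale[OF assms, of "\<lambda>x. f x * g x" c] by (simp add: mult.assoc)
qed

lemma span_bounded_monomials_mult:
  assumes f: "f \<in> real_fun.span (bounded_monomials n d)"
    and g: "g \<in> real_fun.span (bounded_monomials n e)"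
  shows "(\<lambda>x. f x * g x) \<in> real_fun.span (bounded_monomials n (d + e))"
proof -
  let ?V = "real_fun.span (bounded_monomials n (d + e))"
  have V: "real_fun.subspace {f. (\<lambda>x. f x * h x) \<in> ?V}" for h
    by (intro subspace_mult_preimage real_fun.subspace_span)
  have "(\<lambda>x. a x * b x) \<in> ?V" if ab_in: "a \<in> bounded_monomials n d" "b \<in> bounded_monomials n e" for a b
  proof -
    obtain \<alpha> \<beta> where ab: "a = monomial n \<alpha>" "b = monomial n \<beta>"
      and "\<forall>i<n. \<alpha> i \<le> d" "\<forall>i<n. \<beta> i \<le> e"
      using ab_in by (auto simp: bounded_monomials_def)
    then have "monomial n (\<lambda>i. \<alpha> i + \<beta> i) \<in> bounded_monomials n (d + e)"
      by (auto simp: bounded_monomials_def add_mono)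
    moreover have "(\<lambda>x. a x * b x) = monomial n (\<lambda>i. \<alpha> i + \<beta> i)"
      by (rule ext) (simp add: ab monomial_add)
    ultimately show ?thesis
      by (simp add: real_fun.span_base)
  qed
  then have "(\<lambda>x. f x * b x) \<in> ?V" if "b \<in> bounded_monomials n e" for b
    using real_fun.span_induct[OF f V[of b]] that by blast
  then have "(\<lambda>x. g x * f x) \<in> ?V"
    using real_fun.span_induct[OF g V[of f]] by (simp add: mult.commute)
  then show ?thesis
    by (simp add: mult.commute)
qed

lemma one_in_span_bounded_monomials: "(\<lambda>x. 1) \<in> real_fun.span (bounded_monomials n 0)"
proof -
  have "monomial n (\<lambda>_. 0) \<in> bounded_monomials n 0"
    by (auto simp: bounded_monomials_def)
  moreover have "monomial n (\<lambda>_. 0) = (\<lambda>x. 1)"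
    by (auto simp: monomial_def)
  ultimately show ?thesis
    by (simp add: real_fun.span_base)
qed

lemma span_bounded_monomials_power:
  assumes "f \<in> real_fun.span (bounded_monomials n d)"
  shows "(\<lambda>x. f x ^ k) \<in> real_fun.span (bounded_monomials n (k * d))"
proof (induction k)
  case 0
  then show ?case by (simp add: one_in_span_bounded_monomials)
next
  case (Suc k)
  then show ?case
    using span_bounded_monomials_mult[OF assms Suc.IH] by simp
qed

lemma span_bounded_monomials_prod:
  assumes "finite I" "\<And>i. i \<in> I \<Longrightarrow> f i \<in> real_fun.span (bounded_monomials n (d i))"
  shows "(\<lambda>x. \<Prod>i\<in>I. f i x) \<in> real_fun.span (bounded_monomials n (\<Sum>i\<in>I. d i))"
  using assms
proof (induction I rule: finite_induct)
  case empty
  then show ?case by (simp add: one_in_span_bounded_monomials)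
next
  case (insert i I)
  then show ?case
    using span_bounded_monomials_mult[of "f i" n "d i" "\<lambda>x. \<Prod>i\<in>I. f i x" "\<Sum>i\<in>I. d i"] by simp
qed

lemma polynomial_fun_in_span_bounded_monomials:
  assumes "polynomial_fun n p"
  shows "\<exists>d. p \<in> real_fun.span (bounded_monomials n d)"
proof -
  obtain A c where A: "finite A" "\<And>x. p x = (\<Sum>\<alpha>\<in>A. c \<alpha> * monomial n \<alpha> x)"
    using assms unfolding polynomial_fun_def by blast
  define d where "d = (\<Sum>\<alpha>\<in>A. \<Sum>i<n. \<alpha> i)"
  have "\<alpha> i \<le> d" if "\<alpha> \<in> A" "i < n" for \<alpha> i
  proof -
    have "\<alpha> i \<le> (\<Sum>i<n. \<alpha> i)"
      using that by (intro member_le_sum) auto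
    also have "\<dots> \<le> d"
      unfolding d_def using that A(1) by (intro member_le_sum[where f = "\<lambda>\<alpha>. \<Sum>i<n. \<alpha> i"]) auto
    finally show ?thesis .
  qed
  then have "monomial n \<alpha> \<in> bounded_monomials n d" if "\<alpha> \<in> A" for \<alpha>
    using that by (auto simp: bounded_monomials_def)
  then have "(\<Sum>\<alpha>\<in>A. (\<lambda>x. c \<alpha> * monomial n \<alpha> x)) \<in> real_fun.span (bounded_monomials n d)"
    by (intro real_fun.span_sum real_fun.span_scale real_fun.span_base)
  moreover have "p = (\<Sum>\<alpha>\<in>A. (\<lambda>x. c \<alpha> * monomial n \<alpha> x))"
    by (rule ext) (simp add: A(2) sum_fun_apply)
  ultimately show ?thesis
    by auto
qed

text \<open>
  If \<open>D\<close> bounds the degrees of the \<open>f j\<close> in each variable, the \<open>N ^ k\<close> power products of the \<open>f j\<close>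
  with exponents below \<open>N\<close> lie in the span of at most \<open>(k * N * D + 1) ^ n\<close> monomials. As \<open>k > n\<close>, the
  former number is larger for large \<open>N\<close>.
\<close>
lemma polynomial_funs_algebraically_dependent:
  assumes f: "\<And>j. j < k \<Longrightarrow> polynomial_fun n (f j)" and "n < k"
  shows "\<exists>B c. finite B \<and> B \<noteq> {} \<and> B \<subseteq> extensional {0..<k} \<and> (\<forall>\<beta>\<in>B. c \<beta> \<noteq> 0) \<and>
    (\<forall>x. (\<Sum>\<beta>\<in>B. c \<beta> * (\<Prod>j=0..<k. f j x ^ \<beta> j)) = 0)"
proof -
  have "\<forall>j\<in>{..<k}. \<exists>d. f j \<in> real_fun.span (bounded_monomials n d)"
    using f polynomial_fun_in_span_bounded_monomials by auto
  then obtain d where d: "\<And>j. j < k \<Longrightarrow> f j \<in> real_fun.span (bounded_monomials n (d j))"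
    by (metis lessThan_iff)
  define D where "D = (\<Sum>j<k. d j)"
  have fD: "f j \<in> real_fun.span (bounded_monomials n D)" if "j < k" for j
  proof -
    have "d j \<le> D"
      unfolding D_def using that by (intro member_le_sum) auto
    then show ?thesis
      using d[OF that] real_fun.span_mono[OF bounded_monomials_mono] by blast
  qed
  \<comment> \<open>With \<open>K = k D + 1\<close>, the number of monomials is at most \<open>(N K) ^ n\<close>, which is less than
    \<open>N ^ (n + 1)\<close> as soon as \<open>N > K ^ n\<close>.\<close>
  define K where "K = Suc (k * D)"
  define N where "N = Suc (K ^ n)"
  define E where "E = PiE {0..<k} (\<lambda>_. {..<N})"
  define F where "F \<beta> x = (\<Prod>j=0..<k. f j x ^ \<beta> j)" for \<beta> :: "nat \<Rightarrow> nat" and x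
  have E: "finite E" "card E = N ^ k" "E \<subseteq> extensional {0..<k}"
    unfolding E_def by (auto simp: card_PiE PiE_iff intro!: finite_PiE)
  have F: "F \<beta> \<in> real_fun.span (bounded_monomials n (k * (N * D)))" if "\<beta> \<in> E" for \<beta>
  proof -
    have "F \<beta> \<in> real_fun.span (bounded_monomials n (\<Sum>j=0..<k. \<beta> j * D))"
      unfolding F_def[abs_def] by (intro span_bounded_monomials_prod span_bounded_monomials_power fD) auto
    moreover have "(\<Sum>j=0..<k. \<beta> j * D) \<le> (\<Sum>j=0..<k. N * D)"
      using that by (intro sum_mono mult_right_mono) (auto simp: E_def less_imp_le PiE_iff)
    ultimately show ?thesis
      using real_fun.span_mono[OF bounded_monomials_mono] by (simp, blast)
  qed
  show ?thesis
  proof (cases "inj_on F E")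
    \<comment> \<open>Two equal power products are themselves a relation, which a linear dependence between
      the elements of the set \<open>F ` E\<close> cannot express.\<close>
    case False
    then obtain \<beta> \<gamma> where *: "\<beta> \<in> E" "\<gamma> \<in> E" "\<beta> \<noteq> \<gamma>" "F \<beta> = F \<gamma>"
      by (auto simp: inj_on_def)
    show ?thesis
    proof (intro exI[of _ "{\<beta>, \<gamma>}"] exI[of _ "\<lambda>\<delta>. if \<delta> = \<beta> then 1 else -1"] conjI allI)
      fix x
      show "(\<Sum>\<delta>\<in>{\<beta>, \<gamma>}. (if \<delta> = \<beta> then 1 else - 1) * (\<Prod>j = 0..<k. f j x ^ \<delta> j)) = 0"
        using *(3) fun_cong[OF *(4), of x] by (auto simp: F_def)
    qed (use * E in auto)
  next
    case True
    have "Suc (k * (N * D)) \<le> N * K"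
      by (simp add: K_def N_def algebra_simps)
    then have "Suc (k * (N * D)) ^ n \<le> (N * K) ^ n"
      by (rule power_mono) simp
    also have "\<dots> = N ^ n * K ^ n"
      by (rule power_mult_distrib)
    also have "\<dots> < N ^ n * N"
      by (simp add: N_def)
    also have "\<dots> = N ^ Suc n"
      by simp
    also have "\<dots> \<le> N ^ k"
      using \<open>n < k\<close> by (intro power_increasing) (auto simp: N_def)
    finally have "card (bounded_monomials n (k * (N * D))) < card (F ` E)"
      using finite_card_bounded_monomials[of n "k * (N * D)"] E(2) card_image[OF True] by simp
    moreover have "F ` E \<subseteq> real_fun.span (bounded_monomials n (k * (N * D)))"
      using F by blast
    ultimately have "real_fun.dependent (F ` E)"
      using real_fun.independent_span_bound[of "bounded_monomials n (k * (N * D))" "F ` E"]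
        finite_card_bounded_monomials[of n "k * (N * D)"] by auto
    then obtain u where u: "\<exists>v\<in>F ` E. u v \<noteq> 0" "(\<Sum>v\<in>F ` E. (\<lambda>x. u v * v x)) = 0"
      using real_fun.dependent_finite[of "F ` E"] E(1) by auto
    define B where "B = {\<beta> \<in> E. u (F \<beta>) \<noteq> 0}"
    show ?thesis
    proof (intro exI[of _ B] exI[of _ "\<lambda>\<beta>. u (F \<beta>)"] conjI allI)
      fix x
      have "(\<Sum>\<beta>\<in>B. u (F \<beta>) * (\<Prod>j=0..<k. f j x ^ \<beta> j)) = (\<Sum>\<beta>\<in>E. u (F \<beta>) * F \<beta> x)"
        unfolding F_def[symmetric] using E(1) by (intro sum.mono_neutral_left) (auto simp: B_def)
      also have "\<dots> = (\<Sum>v\<in>F ` E. (\<lambda>x. u v * v x)) x"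
        by (simp add: sum_fun_apply sum.reindex[OF True])
      finally show "(\<Sum>\<beta>\<in>B. u (F \<beta>) * (\<Prod>j=0..<k. f j x ^ \<beta> j)) = 0"
        by (simp add: u(2))
    qed (use u E in \<open>auto simp: B_def\<close>)
  qed
qed

section \<open>The dimension of sets with an interior point\<close>

lemma prime_chain_length_le:
  assumes "prime_chain (polynomial_fun_ring n S) k P"
  shows "k \<le> n"
proof (rule ccontr)
  assume "\<not> k \<le> n"
  then have "n < k"
    by simp
  have P: "\<And>i. i \<le> k \<Longrightarrow> primeideal (P i) (polynomial_fun_ring n S)"
    and P_less: "\<And>i. i < k \<Longrightarrow> P i \<subset> P (Suc i)"
    using assms by (auto simp: prime_chain_def)
  have "\<forall>i\<in>{..<k}. \<exists>p. p \<in> polynomial_ideal n S (P (Suc i)) \<and> p \<notin> polynomial_ideal n S (P i)"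
  proof
    fix i assume "i \<in> {..<k}"
    then have "i < k"
      by simp
    then obtain g where g: "g \<in> P (Suc i)" "g \<notin> P i"
      using P_less by blast
    interpret primeideal "P (Suc i)" "polynomial_fun_ring n S"
      using P \<open>i < k\<close> by simp
    obtain p where "polynomial_fun n p" "g = restrict p S"
      using a_Hcarr[OF g(1)] by (auto simp: carrier_polynomial_fun_ring)
    with g show "\<exists>p. p \<in> polynomial_ideal n S (P (Suc i)) \<and> p \<notin> polynomial_ideal n S (P i)"
      by (auto simp: polynomial_ideal_def)
  qed
  then obtain f where f: "\<And>i. i < k \<Longrightarrow> f i \<in> polynomial_ideal n S (P (Suc i))"
    "\<And>i. i < k \<Longrightarrow> f i \<notin> polynomial_ideal n S (P i)"
    by (metis lessThan_iff)
  have f_poly: "\<And>i. i < k \<Longrightarrow> polynomial_fun n (f i)"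
    using f(1) by (auto simp: polynomial_ideal_def)
  obtain B and c :: "(nat \<Rightarrow> nat) \<Rightarrow> real"
    where B: "finite B" "B \<noteq> {}" "B \<subseteq> extensional {0..<k}" "\<And>\<beta>. \<beta> \<in> B \<Longrightarrow> c \<beta> \<noteq> 0"
      and zero: "\<And>x. (\<Sum>\<beta>\<in>B. c \<beta> * (\<Prod>j=0..<k. f j x ^ \<beta> j)) = 0"
    using polynomial_funs_algebraically_dependent[of k n f, OF f_poly \<open>n < k\<close>] by blast
  have "inj_on (\<lambda>\<beta>. restrict \<beta> {0..<k}) B"
    using B(3) by (intro inj_onI) (metis extensional_restrict subsetD)
  then have "(\<lambda>x. \<Sum>\<beta>\<in>B. c \<beta> * (\<Prod>j=0..<k. f j x ^ \<beta> j)) \<notin> polynomial_ideal n S (P 0)"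
    using P_less by (intro relation_notin_prime_chain[where k = k and P = P and n = n and S = S] P f_poly f B) auto
  moreover have "(\<lambda>x. 0) \<in> polynomial_ideal n S (P 0)"
  proof -
    interpret primeideal "P 0" "polynomial_fun_ring n S"
      using P by simp
    show ?thesis
      using additive_subgroup.zero_closed[OF additive_subgroup_axioms]
      by (simp add: polynomial_ideal_def polynomial_fun_ring_simps polynomial_fun_const)
  qed
  ultimately show False
    by (simp add: zero)
qed

text \<open>
  The restriction to a line is a polynomial in one variable, so that finiteness of the set of zeros
  becomes available.
\<close>
lemma polynomial_fun_on_line:
  assumes "polynomial_fun n p"
  shows "\<exists>q. \<forall>s. p (\<lambda>i. u i + s * (v i - u i)) = poly q s"
proof -
  obtain A c where A: "\<And>x. p x = (\<Sum>\<alpha>\<in>A. c \<alpha> * monomial n \<alpha> x)"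
    using assms unfolding polynomial_fun_def by blast
  show ?thesis
    by (intro exI[of _ "\<Sum>\<alpha>\<in>A. smult (c \<alpha>) (\<Prod>i<n. [:u i, v i - u i:] ^ \<alpha> i)"] allI)
      (simp add: A monomial_def poly_sum poly_prod poly_power)
qed

text \<open>
  Convexity, spelled out because the type \<open>nat \<Rightarrow> real\<close> is not a real vector space in the sense of
  the type classes.
\<close>
definition segment_closed :: "(nat \<Rightarrow> real) set \<Rightarrow> bool" where
  "segment_closed C \<longleftrightarrow> (\<forall>u\<in>C. \<forall>v\<in>C. \<forall>s\<in>{0..1}. (\<lambda>i. u i + s * (v i - u i)) \<in> C)"

text \<open>
  If \<open>p\<close> does not vanish at \<open>u\<close> and \<open>q\<close> does not vanish at \<open>v\<close>, then both are nonzero polynomials on the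
  line through \<open>u\<close> and \<open>v\<close>, and their product has only finitely many zeros on it, although it vanishes
  on the whole segment.
\<close>
lemma polynomial_fun_mult_vanishes:
  assumes p: "polynomial_fun n p" and q: "polynomial_fun n q" and C: "segment_closed C"
    and zero: "\<And>x. x \<in> C \<Longrightarrow> p x * q x = 0"
  shows "(\<forall>x\<in>C. p x = 0) \<or> (\<forall>x\<in>C. q x = 0)"
proof (rule ccontr)
  assume "\<not> ?thesis"
  then obtain u v where u: "u \<in> C" "p u \<noteq> 0" and v: "v \<in> C" "q v \<noteq> 0"
    by blast
  obtain P where P: "\<And>s. p (\<lambda>i. u i + s * (v i - u i)) = poly P s"
    using polynomial_fun_on_line[OF p, of u v] by blast
  obtain Q where Q: "\<And>s. q (\<lambda>i. u i + s * (v i - u i)) = poly Q s"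
    using polynomial_fun_on_line[OF q, of u v] by blast
  have "P \<noteq> 0" "Q \<noteq> 0"
    using u(2) v(2) P[of 0] Q[of 1] by auto
  then have "finite {s. poly (P * Q) s = 0}"
    by (intro poly_roots_finite) simp
  moreover have "{0..1} \<subseteq> {s. poly (P * Q) s = 0}"
    using C u(1) v(1) zero by (auto simp: segment_closed_def P[symmetric] Q[symmetric])
  ultimately have "finite {0..1::real}"
    by (rule rev_finite_subset)
  then show False
    using infinite_Icc[of "0::real" 1] by simp
qed

lemma primeideal_vanishing_on_segment_closed:
  assumes C: "C \<subseteq> S" "C \<noteq> {}" "segment_closed C"
  shows "primeideal {f \<in> carrier (polynomial_fun_ring n S). \<forall>x\<in>C. f x = 0} (polynomial_fun_ring n S)"
    (is "primeideal ?I ?R")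
proof -
  interpret cring ?R
    by (rule cring_polynomial_fun_ring)
  have I: "f \<in> ?I \<longleftrightarrow> (\<exists>p. polynomial_fun n p \<and> f = restrict p S \<and> (\<forall>x\<in>C. p x = 0))" for f
    using C(1) by (auto simp: carrier_polynomial_fun_ring subset_iff)
  have minus: "\<ominus>\<^bsub>?R\<^esub> restrict p S = restrict (\<lambda>x. - p x) S" if "polynomial_fun n p" for p
    using that
    by (intro minus_equality)
      (auto simp: carrier_polynomial_fun_ring polynomial_fun_ring_simps intro: polynomial_fun_uminus)
  show ?thesis
  proof (rule primeidealI2)
    show "cring ?R"
      by (rule is_cring)
    show "additive_subgroup ?I ?R"
    proof (rule additive_subgroup.intro, rule group.subgroupI)
      show "group (add_monoid ?R)"
        by (rule a_group)
      show "?I \<noteq> {}"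
        using I[of "restrict (\<lambda>_. 0) S"] polynomial_fun_const by blast
      show "inv\<^bsub>add_monoid ?R\<^esub> f \<in> ?I" if f: "f \<in> ?I" for f
      proof -
        obtain p where p: "polynomial_fun n p" "f = restrict p S" "\<forall>x\<in>C. p x = 0"
          using f I by blast
        have "restrict (\<lambda>x. - p x) S \<in> ?I"
          unfolding I by (intro exI[of _ "\<lambda>x. - p x"]) (simp add: p polynomial_fun_uminus)
        then show ?thesis
          using minus[OF p(1)] by (simp add: a_inv_def p(2))
      qed
      show "f \<otimes>\<^bsub>add_monoid ?R\<^esub> g \<in> ?I" if fg: "f \<in> ?I" "g \<in> ?I" for f g
      proof -
        obtain p where p: "polynomial_fun n p" "f = restrict p S" "\<forall>x\<in>C. p x = 0"
          using I[THEN iffD1, OF fg(1)] by blast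
        obtain q where q: "polynomial_fun n q" "g = restrict q S" "\<forall>x\<in>C. q x = 0"
          using I[THEN iffD1, OF fg(2)] by blast
        show ?thesis
          unfolding I by (intro exI[of _ "\<lambda>x. p x + q x"])
            (simp add: p q polynomial_fun_ring_simps polynomial_fun_add)
      qed
    qed auto
    show mult: "g \<otimes>\<^bsub>?R\<^esub> f \<in> ?I" if fg: "f \<in> ?I" "g \<in> carrier ?R" for f g
    proof -
      obtain p where p: "polynomial_fun n p" "f = restrict p S" "\<forall>x\<in>C. p x = 0"
        using I[THEN iffD1, OF fg(1)] by blast
      obtain q where q: "polynomial_fun n q" "g = restrict q S"
        using fg(2) by (auto simp: carrier_polynomial_fun_ring)
      show ?thesis
        unfolding I by (intro exI[of _ "\<lambda>x. q x * p x"])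
          (simp add: p q polynomial_fun_ring_simps polynomial_fun_mult)
    qed
    show "f \<otimes>\<^bsub>?R\<^esub> g \<in> ?I" if fg: "f \<in> ?I" "g \<in> carrier ?R" for f g
      using mult[OF fg] fg m_comm[of f g] by simp
    show "carrier ?R \<noteq> ?I"
    proof
      assume "carrier ?R = ?I"
      then have "\<one>\<^bsub>?R\<^esub> \<in> ?I"
        using one_closed by blast
      moreover obtain x where "x \<in> C"
        using C(2) by blast
      ultimately show False
        using C(1) by (auto simp: polynomial_fun_ring_simps subset_iff)
    qed
    show "f \<in> ?I \<or> g \<in> ?I"
      if fg: "f \<in> carrier ?R" "g \<in> carrier ?R" "f \<otimes>\<^bsub>?R\<^esub> g \<in> ?I" for f g
    proof -
      obtain p where p: "polynomial_fun n p" "f = restrict p S"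
        using fg(1) by (auto simp: carrier_polynomial_fun_ring)
      obtain q where q: "polynomial_fun n q" "g = restrict q S"
        using fg(2) by (auto simp: carrier_polynomial_fun_ring)
      have "restrict (\<lambda>x. p x * q x) S x = 0" if "x \<in> C" for x
        using fg(3) that by (simp add: p q polynomial_fun_ring_simps)
      then have "p x * q x = 0" if "x \<in> C" for x
        using that C(1) by (metis restrict_apply' subsetD)
      from polynomial_fun_mult_vanishes[OF p(1) q(1) C(3) this] show ?thesis
        unfolding I using p q by blast
    qed
  qed
qed

lemma open_box_in_openin_Euclidean_space:
  assumes "openin (Euclidean_space n) U" "a \<in> U"
  obtains e :: "nat \<Rightarrow> real" where "\<And>i. e i > 0"
    "{x \<in> topspace (Euclidean_space n). \<forall>i. \<bar>x i - a i\<bar> < e i} \<subseteq> U"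
proof -
  obtain W where W: "openin (powertop_real UNIV) W" "U = W \<inter> {x. \<forall>i\<ge>n. x i = 0}"
    using assms(1) by (auto simp: Euclidean_space_def openin_subtopology)
  have "a \<in> W"
    using assms(2) W(2) by simp
  then have "\<exists>X. a \<in> PiE UNIV X \<and> (\<forall>i. open (X i)) \<and> PiE UNIV X \<subseteq> W"
    using product_topology_open_contains_basis[OF W(1), of a] by auto
  then obtain X where X: "a \<in> PiE UNIV X" "\<And>i. open (X i)" "PiE UNIV X \<subseteq> W"
    by blast
  have "\<forall>i. \<exists>e>0. ball (a i) e \<subseteq> X i"
    using X(1,2) open_contains_ball by blast
  then obtain e where e: "\<And>i. e i > 0" "\<And>i. ball (a i) (e i) \<subseteq> X i"
    by metis
  have "{x \<in> topspace (Euclidean_space n). \<forall>i. \<bar>x i - a i\<bar> < e i} \<subseteq> U"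
  proof
    fix x assume x: "x \<in> {x \<in> topspace (Euclidean_space n). \<forall>i. \<bar>x i - a i\<bar> < e i}"
    have "x i \<in> X i" for i
      using x e(2)[of i] by (auto simp: subset_iff dist_real_def abs_minus_commute)
    then show "x \<in> U"
      using x X(3) W(2) by (auto simp: topspace_Euclidean_space)
  qed
  with e(1) that show thesis
    by blast
qed

text \<open>
  The \<open>k\<close>-th prime consists of the functions that vanish on the slice \<open>C k\<close> of a box around \<open>a\<close>
  in which the first \<open>k\<close> coordinates are fixed. The function \<open>x k - a k\<close> shows that the chain is strict.
\<close>
lemma prime_chain_of_interior_point:
  assumes "a \<in> Euclidean_space n interior_of S"
  shows "\<exists>P. prime_chain (polynomial_fun_ring n S) n P"
proof -
  let ?E = "topspace (Euclidean_space n)" and ?R = "polynomial_fun_ring n S"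
  obtain e where e: "\<And>i. e i > 0"
    and box: "{x \<in> ?E. \<forall>i. \<bar>x i - a i\<bar> < e i} \<subseteq> Euclidean_space n interior_of S"
    using open_box_in_openin_Euclidean_space[OF openin_interior_of assms] by blast
  define C where "C k = {x \<in> ?E. (\<forall>i. \<bar>x i - a i\<bar> < e i) \<and> (\<forall>j<k. x j = a j)}" for k
  define P where "P k = {f \<in> carrier ?R. \<forall>x\<in>C k. f x = 0}" for k
  have a: "a \<in> ?E"
    using assms interior_of_subset_topspace[of "Euclidean_space n" S] by (rule subsetD[rotated])
  have C_subset: "C k \<subseteq> S" for k
    using box interior_of_subset by (fastforce simp: C_def)
  have "a \<in> C k" for k
    using a e by (simp add: C_def)
  have "segment_closed (C k)" for k
    unfolding segment_closed_def
  proof (intro ballI)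
    fix u v and s :: real assume u: "u \<in> C k" and v: "v \<in> C k" and s: "s \<in> {0..1}"
    have "\<bar>(u i + s * (v i - u i)) - a i\<bar> < e i" for i
    proof -
      have "u i \<in> ball (a i) (e i)" "v i \<in> ball (a i) (e i)"
        using u v by (auto simp: C_def dist_real_def abs_minus_commute)
      then have "(1 - s) *\<^sub>R u i + s *\<^sub>R v i \<in> ball (a i) (e i)"
        using s by (intro convexD convex_ball) auto
      then show ?thesis
        by (simp add: dist_real_def abs_minus_commute algebra_simps)
    qed
    then show "(\<lambda>i. u i + s * (v i - u i)) \<in> C k"
      using u v by (auto simp: C_def topspace_Euclidean_space)
  qed
  then have "primeideal (P k) ?R" for k
    unfolding P_def using C_subset \<open>a \<in> C k\<close> by (intro primeideal_vanishing_on_segment_closed) auto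
  moreover have "P k \<subset> P (Suc k)" if "k < n" for k
  proof
    show "P k \<subseteq> P (Suc k)"
      by (auto simp: P_def C_def)
    define f where "f = restrict (\<lambda>x. x k + - a k) S"
    have "f \<in> carrier ?R"
      unfolding f_def carrier_polynomial_fun_ring using that
      by (intro exI[of _ "\<lambda>x. x k + - a k"])
        (use polynomial_fun_add[OF polynomial_fun_coordinate polynomial_fun_const[of n "- a k"]] that in simp)
    moreover have "f x = 0" if "x \<in> C (Suc k)" for x
      using that C_subset[of "Suc k"] by (auto simp: f_def C_def)
    moreover have "\<exists>x\<in>C k. f x \<noteq> 0"
    proof
      let ?x = "a(k := a k + e k / 2)"
      show "?x \<in> C k"
        using a e that by (auto simp: C_def topspace_Euclidean_space abs_of_pos[OF e])
      with C_subset[of k] show "f ?x \<noteq> 0"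
        using e[of k] by (auto simp: f_def)
    qed
    ultimately have "f \<in> P (Suc k)" "f \<notin> P k"
      by (auto simp: P_def)
    then show "P k \<noteq> P (Suc k)"
      by blast
  qed
  ultimately show ?thesis
    by (auto simp: prime_chain_def)
qed

theorem semialgebraic_dim_of_interior:
  assumes "Euclidean_space n interior_of S \<noteq> {}"
  shows "semialgebraic_dim n S = ereal (real n)"
  unfolding semialgebraic_dim_def krull_dim_def
proof (rule antisym)
  show "(SUP k\<in>{k. \<exists>P. prime_chain (polynomial_fun_ring n S) k P}. ereal (real k)) \<le> ereal (real n)"
    using prime_chain_length_le by (intro SUP_least) fastforce
  show "ereal (real n) \<le> (SUP k\<in>{k. \<exists>P. prime_chain (polynomial_fun_ring n S) k P}. ereal (real k))"
    using assms prime_chain_of_interior_point by (intro SUP_upper) blast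
qed

section \<open>Blocks of coordinates\<close>

lemma sum_lessThan_add:
  "(\<Sum>j<a + b. f j) = (\<Sum>j<a. f j) + (\<Sum>j<b. f (a + j))" for f :: "nat \<Rightarrow> 'a::comm_monoid_add" and a b :: nat
  by (induction b) (auto simp: add.assoc)

lemma sum_lessThan_blocks:
  "(\<Sum>j<sum n {..<l}. f j) = (\<Sum>i<l. \<Sum>j<n i. f (sum n {..<i} + j))"
  for f :: "nat \<Rightarrow> 'a::comm_monoid_add" and l :: nat
  by (induction l) (auto simp: sum_lessThan_add)

lemma sum_lessThan_mono: "i \<le> k \<Longrightarrow> sum n {..<i} \<le> sum n {..<k}" for n :: "nat \<Rightarrow> nat"
  by (intro sum_mono2) auto

lemma offset_add_less: 
  fixes n :: "nat \<Rightarrow> nat"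
  assumes "i < l" "j < n i"
  shows "sum n {..<i} + j < sum n {..<l}"
  using assms sum_lessThan_mono[of "Suc i" l n] by simp

lemma index_in_block:
  fixes n :: "nat \<Rightarrow> nat"
  assumes "j < sum n {..<l}"
  shows "\<exists>i<l. \<exists>r<n i. j = sum n {..<i} + r"
  using assms
proof (induction l)
  case (Suc l)
  show ?case
  proof (cases "j < sum n {..<l}")
    case True
    then show ?thesis
      using Suc.IH less_SucI by blast
  next
    case False
    then show ?thesis
      using Suc.prems by (intro exI[of _ l] exI[of _ "j - sum n {..<l}"] conjI) auto
  qed
qed simp

text \<open>
  The concatenation of vectors \<open>X i\<close> of lengths \<open>n i\<close>. It is written as a sum, in which at
  most one term is nonzero, because polynomials are closed under sums.
\<close>
definition assemble :: "(nat \<Rightarrow> nat) \<Rightarrow> nat \<Rightarrow> (nat \<Rightarrow> nat \<Rightarrow> real) \<Rightarrow> nat \<Rightarrow> real" where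
  "assemble n l X =
     (\<lambda>j. \<Sum>i<l. if sum n {..<i} \<le> j \<and> j < sum n {..<Suc i} then X i (j - sum n {..<i}) else 0)"

lemma assemble_at:
  assumes "i < l" "j < n i"
  shows "assemble n l X (sum n {..<i} + j) = X i j"
proof -
  let ?k = "sum n {..<i} + j"
  have "(if sum n {..<i'} \<le> ?k \<and> ?k < sum n {..<Suc i'} then X i' (?k - sum n {..<i'}) else 0) =
      (if i' = i then X i j else 0)" for i'
  proof (cases i' i rule: linorder_cases)
    case less
    then show ?thesis
      using sum_lessThan_mono[of "Suc i'" i n] by simp
  next
    case equal
    then show ?thesis
      using assms(2) by simp
  next
    case greater
    then show ?thesis
      using sum_lessThan_mono[of "Suc i" i' n] assms(2) by simp
  qed
  then show ?thesis
    using assms(1) by (simp add: assemble_def)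
qed

lemma assemble_eq_0: "sum n {..<l} \<le> j \<Longrightarrow> assemble n l X j = 0"
  unfolding assemble_def
proof (intro sum.neutral ballI)
  fix i assume "sum n {..<l} \<le> j" "i \<in> {..<l}"
  then have "sum n {..<Suc i} \<le> j"
    using sum_lessThan_mono[of "Suc i" l n] by simp
  then show "(if sum n {..<i} \<le> j \<and> j < sum n {..<Suc i} then X i (j - sum n {..<i}) else 0) = 0"
    by simp
qed

lemma assemble_in_topspace: "assemble n l X \<in> topspace (Euclidean_space (sum n {..<l}))"
  by (simp add: topspace_Euclidean_space assemble_eq_0)

lemma assemble_cong: "(\<And>i. i < l \<Longrightarrow> X i = Y i) \<Longrightarrow> assemble n l X = assemble n l Y"
  by (auto simp: assemble_def intro!: ext sum.cong)

lemma block_in_topspace: "block n i x \<in> topspace (Euclidean_space (n i))"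
  by (simp add: block_def topspace_Euclidean_space)

lemma block_assemble:
  assumes "i < l" "X i \<in> topspace (Euclidean_space (n i))"
  shows "block n i (assemble n l X) = X i"
  using assms by (auto simp: block_def assemble_at topspace_Euclidean_space not_less)

lemma assemble_block:
  assumes "x \<in> topspace (Euclidean_space (sum n {..<l}))"
  shows "assemble n l (\<lambda>i. block n i x) = x"
proof
  fix j
  show "assemble n l (\<lambda>i. block n i x) j = x j"
  proof (cases "j < sum n {..<l}")
    case True
    then obtain i r where "i < l" "r < n i" "j = sum n {..<i} + r"
      using index_in_block by blast
    then show ?thesis
      by (simp add: assemble_at) (simp add: block_def)
  next
    case False
    then show ?thesis
      using assms by (simp add: assemble_eq_0 topspace_Euclidean_space)
  qed
qed

lemma polynomial_fun_block:
  assumes "i < l"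
  shows "polynomial_fun (sum n {..<l}) (\<lambda>x. block n i x j)"
  by (cases "j < n i")
    (simp_all add: block_def polynomial_fun_const polynomial_fun_coordinate offset_add_less assms)

lemma continuous_map_block:
  "continuous_map (Euclidean_space N) (Euclidean_space (n i)) (block n i)"
proof -
  have "continuous_map (Euclidean_space N) euclideanreal (\<lambda>x. x j)" for j
    unfolding Euclidean_space_def
    by (intro continuous_map_from_subtopology continuous_map_product_projection) auto
  then show ?thesis
    by (simp add: block_def[abs_def] continuous_map_componentwise_Euclidean_space)
qed

section \<open>A polynomial map from a ball onto a product of balls\<close>

definition sqnorm :: "nat \<Rightarrow> (nat \<Rightarrow> real) \<Rightarrow> real" where
  "sqnorm m x = (\<Sum>i<m. (x i)\<^sup>2)"

lemma sqnorm_nonneg: "sqnorm m x \<ge> 0"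
  by (simp add: sqnorm_def sum_nonneg)

lemma closed_unit_ball_iff:
  "x \<in> closed_unit_ball m \<longleftrightarrow> x \<in> topspace (Euclidean_space m) \<and> sqnorm m x \<le> 1"
  by (simp add: closed_unit_ball_def sqnorm_def)

lemma sqnorm_scale: "sqnorm m (\<lambda>j. x j * s) = sqnorm m x * s\<^sup>2"
  by (simp add: sqnorm_def power_mult_distrib sum_distrib_right)

lemma sqnorm_blocks: "sqnorm (sum m {..<l}) x = (\<Sum>i<l. sqnorm (m i) (block m i x))"
  by (simp add: sqnorm_def sum_lessThan_blocks block_def)

text \<open>
  On each ray this is the function \<open>r \<mapsto> 3 r - 4 r\<^sup>3\<close>, for which \<open>sin (3 \<phi>) = 3 sin \<phi> - 4 sin\<^sup>3 \<phi>\<close>. It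
  maps \<open>[0, 1/2]\<close> onto \<open>[0, 1]\<close>, and its absolute value is at most \<open>1\<close> on all of \<open>[0, 1]\<close>.
\<close>
definition cubic_fold :: "nat \<Rightarrow> (nat \<Rightarrow> real) \<Rightarrow> nat \<Rightarrow> real" where
  "cubic_fold m x = (\<lambda>j. x j * (3 - 4 * sqnorm m x))"

lemma cubic_fold_in_closed_unit_ball:
  assumes "x \<in> closed_unit_ball m"
  shows "cubic_fold m x \<in> closed_unit_ball m"
proof -
  let ?r = "sqnorm m x"
  have "1 - ?r * (3 - 4 * ?r)\<^sup>2 = (1 - ?r) * (1 - 4 * ?r)\<^sup>2"
    by (simp add: power2_eq_square algebra_simps)
  moreover have "(1 - ?r) * (1 - 4 * ?r)\<^sup>2 \<ge> 0"
    using assms by (simp add: closed_unit_ball_iff)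
  ultimately have "?r * (3 - 4 * ?r)\<^sup>2 \<le> 1"
    by linarith
  moreover have "cubic_fold m x \<in> topspace (Euclidean_space m)"
    using assms by (simp add: closed_unit_ball_iff topspace_Euclidean_space cubic_fold_def)
  ultimately show ?thesis
    by (simp add: closed_unit_ball_iff cubic_fold_def sqnorm_scale)
qed

text \<open>
  The preimage is the multiple \<open>s y\<close> with \<open>s \<in> [0, 1/2]\<close> and \<open>s (3 - 4 \<bar>y\<bar>\<^sup>2 s\<^sup>2) = 1\<close>. Such an \<open>s\<close> exists
  because the left-hand side is \<open>0\<close> at \<open>s = 0\<close> and \<open>(3 - \<bar>y\<bar>\<^sup>2) / 2 \<ge> 1\<close> at \<open>s = 1/2\<close>.
\<close>
lemma cubic_fold_preimage:
  assumes "y \<in> closed_unit_ball m"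
  obtains x where "x \<in> closed_unit_ball m" "sqnorm m x \<le> sqnorm m y / 4" "cubic_fold m x = y"
proof -
  let ?r = "sqnorm m y"
  have r: "0 \<le> ?r" "?r \<le> 1"
    using assms by (simp_all add: sqnorm_nonneg closed_unit_ball_iff)
  have "\<exists>s\<ge>0. s \<le> 1/2 \<and> s * (3 - 4 * (?r * s\<^sup>2)) = 1"
    using r by (intro IVT' continuous_intros) (auto simp: power2_eq_square)
  then obtain s where s: "0 \<le> s" "s \<le> 1/2" "s * (3 - 4 * (?r * s\<^sup>2)) = 1"
    by blast
  define x where "x j = y j * s" for j
  have "s\<^sup>2 \<le> (1/2)\<^sup>2"
    using s by (intro power_mono)
  then have "?r * s\<^sup>2 \<le> ?r * (1/2)\<^sup>2"
    using r by (intro mult_left_mono)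
  then have x_norm: "sqnorm m x \<le> ?r / 4"
    unfolding x_def sqnorm_scale by (simp add: power2_eq_square)
  show thesis
  proof
    show "x \<in> closed_unit_ball m"
      using x_norm r assms by (simp add: closed_unit_ball_iff topspace_Euclidean_space x_def)
    show "sqnorm m x \<le> ?r / 4"
      by (rule x_norm)
    have "cubic_fold m x j = y j * (s * (3 - 4 * (?r * s\<^sup>2)))" for j
      unfolding cubic_fold_def x_def sqnorm_scale by (simp add: mult.assoc)
    then show "cubic_fold m x = y"
      by (simp add: s(3) fun_eq_iff)
  qed
qed

lemma iterated_cubic_fold_in_closed_unit_ball:
  "x \<in> closed_unit_ball m \<Longrightarrow> (cubic_fold m ^^ k) x \<in> closed_unit_ball m"
  by (induction k) (auto intro: cubic_fold_in_closed_unit_ball)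

lemma iterated_cubic_fold_preimage:
  assumes "y \<in> closed_unit_ball m"
  shows "\<exists>x\<in>closed_unit_ball m. sqnorm m x \<le> (1/4) ^ k \<and> (cubic_fold m ^^ k) x = y"
proof (induction k)
  case 0
  then show ?case
    using assms by (auto simp: closed_unit_ball_iff)
next
  case (Suc k)
  then obtain x' where x': "x' \<in> closed_unit_ball m" "sqnorm m x' \<le> (1/4) ^ k"
    "(cubic_fold m ^^ k) x' = y"
    by blast
  obtain x where x: "x \<in> closed_unit_ball m" "sqnorm m x \<le> sqnorm m x' / 4" "cubic_fold m x = x'"
    using cubic_fold_preimage[OF x'(1)] .
  have "(cubic_fold m ^^ Suc k) x = y"
    by (simp add: funpow_Suc_right x(3) x'(3) del: funpow.simps)
  moreover have "sqnorm m x \<le> (1/4) ^ Suc k"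
    using x(2) x'(2) by simp
  ultimately show ?case
    using x(1) by blast
qed

lemma polynomial_fun_iterated_cubic_fold:
  "j < m \<Longrightarrow> polynomial_fun m (\<lambda>x. (cubic_fold m ^^ k) x j)"
proof (induction k arbitrary: j)
  case 0
  then show ?case by (simp add: polynomial_fun_coordinate)
next
  case (Suc k)
  let ?g = "\<lambda>x. (cubic_fold m ^^ k) x"
  have "polynomial_fun m (\<lambda>x. ?g x j * (3 + (- 4) * (\<Sum>i<m. (?g x i)\<^sup>2)))"
    using Suc by (intro polynomial_fun_mult polynomial_fun_add polynomial_fun_const
        polynomial_fun_sum polynomial_fun_power) auto
  moreover have "(cubic_fold m ^^ Suc k) x j = ?g x j * (3 + (- 4) * (\<Sum>i<m. (?g x i)\<^sup>2))" for x
    by (simp add: cubic_fold_def sqnorm_def)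
  ultimately show ?case
    by simp
qed

definition folded_block :: "(nat \<Rightarrow> nat) \<Rightarrow> nat \<Rightarrow> nat \<Rightarrow> (nat \<Rightarrow> real) \<Rightarrow> nat \<Rightarrow> real" where
  "folded_block m l i x = (cubic_fold (m i) ^^ l) (block m i x)"

lemma polynomial_fun_folded_block:
  assumes "i < l" "j < m i"
  shows "polynomial_fun (sum m {..<l}) (\<lambda>x. folded_block m l i x j)"
  unfolding folded_block_def
  by (intro polynomial_fun_compose[OF polynomial_fun_iterated_cubic_fold] polynomial_fun_block assms)

lemma folded_block_in_closed_unit_ball:
  assumes "x \<in> closed_unit_ball (sum m {..<l})" "i < l"
  shows "folded_block m l i x \<in> closed_unit_ball (m i)"
proof -
  have "sqnorm (m i) (block m i x) \<le> sqnorm (sum m {..<l}) x"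
    unfolding sqnorm_blocks using assms(2)
    by (intro member_le_sum[where f = "\<lambda>i. sqnorm (m i) (block m i x)"]) (auto simp: sqnorm_nonneg)
  then have "block m i x \<in> closed_unit_ball (m i)"
    using assms(1) block_in_topspace by (auto simp: closed_unit_ball_iff)
  then show ?thesis
    unfolding folded_block_def by (rule iterated_cubic_fold_in_closed_unit_ball)
qed

text \<open>
  Every \<open>y i\<close> has a preimage of squared norm at most \<open>4\<^sup>-\<^sup>l\<close>, and \<open>l\<close> such blocks have a total squared norm
  of at most \<open>l 4\<^sup>-\<^sup>l \<le> 1\<close>. This is why the fold is iterated \<open>l\<close> times.
\<close>
lemma folded_blocks_onto_product_of_balls:
  assumes "\<And>i. i < l \<Longrightarrow> y i \<in> closed_unit_ball (m i)"
  shows "\<exists>x\<in>closed_unit_ball (sum m {..<l}). \<forall>i<l. folded_block m l i x = y i"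
proof -
  have "\<forall>i\<in>{..<l}. \<exists>x\<in>closed_unit_ball (m i). sqnorm (m i) x \<le> (1/4) ^ l \<and> (cubic_fold (m i) ^^ l) x = y i"
    using iterated_cubic_fold_preimage assms by simp
  then obtain X where X: "\<And>i. i < l \<Longrightarrow> X i \<in> closed_unit_ball (m i)"
    "\<And>i. i < l \<Longrightarrow> sqnorm (m i) (X i) \<le> (1/4) ^ l"
    "\<And>i. i < l \<Longrightarrow> (cubic_fold (m i) ^^ l) (X i) = y i"
    by (metis lessThan_iff)
  define x where "x = assemble m l X"
  have block: "block m i x = X i" if "i < l" for i
    unfolding x_def using that X(1)[OF that] by (intro block_assemble) (auto simp: closed_unit_ball_iff)
  have "sqnorm (sum m {..<l}) x = (\<Sum>i<l. sqnorm (m i) (X i))"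
    unfolding sqnorm_blocks by (intro sum.cong) (auto simp: block)
  also have "\<dots> \<le> (\<Sum>i<l. (1/4) ^ l)"
    by (intro sum_mono X(2)) auto
  also have "\<dots> = real l / 4 ^ l"
    by (simp add: power_one_over)
  also have "\<dots> \<le> 1"
  proof -
    have "real l \<le> real (4 ^ l)"
      using power_gt_expt[of 4 l] by (intro of_nat_mono) simp
    then show ?thesis
      by simp
  qed
  finally have "x \<in> closed_unit_ball (sum m {..<l})"
    by (simp add: closed_unit_ball_iff x_def assemble_in_topspace)
  moreover have "folded_block m l i x = y i" if "i < l" for i
    by (simp add: folded_block_def block X(3) that)
  ultimately show ?thesis
    by blast
qed

section \<open>Products of bricks\<close>

lemma semialgebraic_topspace: "semialgebraic n (topspace (Euclidean_space n))"
  using semialgebraic.positive[OF polynomial_fun_const[of n 1]] by simp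

lemma semialgebraic_polynomial_preimage:
  assumes "semialgebraic n S" and g: "\<And>j. j < n \<Longrightarrow> polynomial_fun k (\<lambda>x. g x j)"
    and g_in: "\<And>x. x \<in> topspace (Euclidean_space k) \<Longrightarrow> g x \<in> topspace (Euclidean_space n)"
  shows "semialgebraic k {x \<in> topspace (Euclidean_space k). g x \<in> S}"
  using assms(1)
proof (induction rule: semialgebraic.induct)
  case (positive p)
  have "{x \<in> topspace (Euclidean_space k). g x \<in> {x \<in> topspace (Euclidean_space n). p x > 0}} =
      {x \<in> topspace (Euclidean_space k). p (g x) > 0}"
    using g_in by auto
  then show ?case
    using semialgebraic.positive[OF polynomial_fun_compose[OF positive g]] by simp
next
  case (union S T)
  have "{x \<in> topspace (Euclidean_space k). g x \<in> S \<union> T} =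
      {x \<in> topspace (Euclidean_space k). g x \<in> S} \<union> {x \<in> topspace (Euclidean_space k). g x \<in> T}"
    by auto
  then show ?case
    using semialgebraic.union union.IH by simp
next
  case (intersection S T)
  have "{x \<in> topspace (Euclidean_space k). g x \<in> S \<inter> T} =
      {x \<in> topspace (Euclidean_space k). g x \<in> S} \<inter> {x \<in> topspace (Euclidean_space k). g x \<in> T}"
    by auto
  then show ?case
    using semialgebraic.intersection intersection.IH by simp
next
  case (complement S)
  have "{x \<in> topspace (Euclidean_space k). g x \<in> topspace (Euclidean_space n) - S} =
      topspace (Euclidean_space k) - {x \<in> topspace (Euclidean_space k). g x \<in> S}"
    using g_in by auto
  then show ?case
    using semialgebraic.complement complement.IH by simp
qed

lemma semialgebraic_block_product:
  assumes "\<And>i. i < l \<Longrightarrow> semialgebraic (n i) (S i)"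
  shows "semialgebraic (sum n {..<l}) (block_product n l S)"
proof -
  have "semialgebraic (sum n {..<l}) {x \<in> topspace (Euclidean_space (sum n {..<l})). \<forall>i<k. block n i x \<in> S i}"
    if "k \<le> l" for k
    using that
  proof (induction k)
    case 0
    then show ?case by (simp add: semialgebraic_topspace)
  next
    case (Suc k)
    let ?E = "topspace (Euclidean_space (sum n {..<l}))"
    have "semialgebraic (sum n {..<l}) {x \<in> ?E. block n k x \<in> S k}"
      using Suc.prems assms block_in_topspace
      by (intro semialgebraic_polynomial_preimage[where n = "n k"] polynomial_fun_block) auto
    moreover have "{x \<in> ?E. \<forall>i<Suc k. block n i x \<in> S i} =
        {x \<in> ?E. \<forall>i<k. block n i x \<in> S i} \<inter> {x \<in> ?E. block n k x \<in> S k}"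
      by (auto simp: less_Suc_eq)
    ultimately show ?case
      using semialgebraic.intersection Suc by simp
  qed
  then show ?thesis
    by (simp add: block_product_def)
qed

lemma openin_block_product:
  assumes "\<And>i. i < l \<Longrightarrow> openin (Euclidean_space (n i)) (U i)"
  shows "openin (Euclidean_space (sum n {..<l})) (block_product n l U)"
proof -
  let ?E = "Euclidean_space (sum n {..<l})"
  have "openin ?E {x \<in> topspace ?E. \<forall>i<k. block n i x \<in> U i}" if "k \<le> l" for k
    using that
  proof (induction k)
    case 0
    then show ?case by simp
  next
    case (Suc k)
    have "openin ?E {x \<in> topspace ?E. block n k x \<in> U k}"
      using Suc.prems assms by (intro openin_continuous_map_preimage[OF continuous_map_block]) auto
    moreover have "{x \<in> topspace ?E. \<forall>i<Suc k. block n i x \<in> U i} =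
        {x \<in> topspace ?E. \<forall>i<k. block n i x \<in> U i} \<inter> {x \<in> topspace ?E. block n k x \<in> U k}"
      by (auto simp: less_Suc_eq)
    ultimately show ?case
      using openin_Int Suc by simp
  qed
  then show ?thesis
    by (simp add: block_product_def)
qed

lemma assemble_in_block_product_iff:
  assumes "\<And>i. i < l \<Longrightarrow> X i \<in> topspace (Euclidean_space (n i))"
  shows "assemble n l X \<in> block_product n l S \<longleftrightarrow> (\<forall>i<l. X i \<in> S i)"
  using assms by (simp add: block_product_def assemble_in_topspace block_assemble)

definition brick_homotopy ::
  "nat \<Rightarrow> nat \<Rightarrow> (nat \<Rightarrow> real) set \<Rightarrow> (real \<times> (nat \<Rightarrow> real) \<Rightarrow> nat \<Rightarrow> real) \<Rightarrow> bool" where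
  "brick_homotopy m n T H \<longleftrightarrow>
     continuous_map
       (prod_topology (top_of_set {0..1}) (subtopology (Euclidean_space m) (closed_unit_ball m)))
       (subtopology (Euclidean_space n) T) H \<and>
     (\<forall>i<n. polynomial_over_C0 m (closed_unit_ball m) (\<lambda>z. H z i)) \<and>
     H ` ({0} \<times> closed_unit_ball m) = T \<and>
     (\<exists>a. \<forall>x\<in>closed_unit_ball m. H (1, x) = a) \<and>
     (\<forall>t\<in>{0<..<1}. H ` ({t} \<times> closed_unit_ball m) \<subseteq> Euclidean_space n interior_of T)"

lemma brick_iff_homotopy:
  "brick m n T \<longleftrightarrow> semialgebraic n T \<and> semialgebraic_dim n T = ereal (real n) \<and>
    (\<exists>H. brick_homotopy m n T H)"
  by (simp add: brick_def brick_homotopy_def)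

theorem corollary2p12:
  fixes l :: nat and m n :: "nat \<Rightarrow> nat" and S :: "nat \<Rightarrow> (nat \<Rightarrow> real) set"
  assumes "l \<ge> 1"
    and "\<And>i. i < l \<Longrightarrow> m i \<ge> 1"
    and "\<And>i. i < l \<Longrightarrow> brick (m i) (n i) (S i)"
  shows "semialgebraic_dim (\<Sum>i<l. n i) (block_product n l S) = ereal (real (\<Sum>i<l. n i)) \<and>
    brick (\<Sum>i<l. m i) (\<Sum>i<l. n i) (block_product n l S)"
proof -
  let ?B = "\<lambda>m. closed_unit_ball m" and ?E = "Euclidean_space"
  let ?M = "sum m {..<l}" and ?N = "sum n {..<l}" and ?S = "block_product n l S"
  have "\<forall>i\<in>{..<l}. \<exists>H. brick_homotopy (m i) (n i) (S i) H"
    using assms(3) by (simp add: brick_iff_homotopy)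
  then obtain H where "\<forall>i\<in>{..<l}. brick_homotopy (m i) (n i) (S i) (H i)"
    by (rule bchoice[THEN exE])
  then have H: "\<And>i. i < l \<Longrightarrow> continuous_map
          (prod_topology (top_of_set {0..1}) (subtopology (?E (m i)) (?B (m i))))
          (subtopology (?E (n i)) (S i)) (H i)"
    "\<And>i j. i < l \<Longrightarrow> j < n i \<Longrightarrow> polynomial_over_C0 (m i) (?B (m i)) (\<lambda>z. H i z j)"
    "\<And>i. i < l \<Longrightarrow> H i ` ({0} \<times> ?B (m i)) = S i"
    "\<And>i. i < l \<Longrightarrow> \<exists>a. \<forall>x\<in>?B (m i). H i (1, x) = a"
    "\<And>i t. i < l \<Longrightarrow> t \<in> {0<..<1} \<Longrightarrow> H i ` ({t} \<times> ?B (m i)) \<subseteq> ?E (n i) interior_of S i"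
    unfolding brick_homotopy_def by simp_all
  have H_in: "H i (t, x) \<in> S i \<inter> topspace (?E (n i))" if "i < l" "t \<in> {0..1}" "x \<in> ?B (m i)" for i t x
    using continuous_map_funspace[OF H(1)[OF \<open>i < l\<close>]] that
    by (auto simp: closed_unit_ball_iff Pi_iff)
  define G where "G z = assemble n l (\<lambda>i. H i (fst z, folded_block m l i (snd z)))" for z
  have fold_in: "folded_block m l i x \<in> ?B (m i)" if "x \<in> ?B ?M" "i < l" for i x
    using that by (rule folded_block_in_closed_unit_ball)
  have G_iff: "G (t, x) \<in> block_product n l T \<longleftrightarrow> (\<forall>i<l. H i (t, folded_block m l i x) \<in> T i)"
    if "t \<in> {0..1}" "x \<in> ?B ?M" for t x T
    unfolding G_def fst_conv snd_conv
    by (rule assemble_in_block_product_iff) (use H_in fold_in that in blast)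
  have G_in: "G (t, x) \<in> ?S" if "t \<in> {0..1}" "x \<in> ?B ?M" for t x
    using G_iff[OF that] H_in fold_in that by blast
  have G_poly: "polynomial_over_C0 ?M (?B ?M) (\<lambda>z. G z j)" for j
    unfolding G_def assemble_def
  proof (rule polynomial_over_C0_sum)
    fix i assume "i \<in> {..<l}"
    then have i: "i < l"
      by simp
    have coordinate: "polynomial_over_C0 ?M (?B ?M) (\<lambda>z. H i (fst z, folded_block m l i (snd z)) r)"
      if "r < n i" for r
      using H(2)[OF i that]
      by (rule polynomial_over_C0_compose)
        (auto intro!: polynomial_over_C0_of_polynomial_fun polynomial_fun_folded_block fold_in i)
    have "polynomial_over_C0 ?M (?B ?M)
        (\<lambda>z. H i (fst z, folded_block m l i (snd z)) (j - sum n {..<i}))"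
      if "sum n {..<i} \<le> j \<and> j < sum n {..<Suc i}"
      by (rule coordinate) (use that in auto)
    then show "polynomial_over_C0 ?M (?B ?M) (\<lambda>z. if sum n {..<i} \<le> j \<and> j < sum n {..<Suc i}
        then H i (fst z, folded_block m l i (snd z)) (j - sum n {..<i}) else 0)"
      by (cases "sum n {..<i} \<le> j \<and> j < sum n {..<Suc i}")
        (simp_all only: if_True if_False simp_thms polynomial_over_C0_const)
  qed
  have G_cont: "continuous_map (prod_topology (top_of_set {0..1}) (subtopology (?E ?M) (?B ?M)))
      (subtopology (?E ?N) ?S) G"
    unfolding continuous_map_in_subtopology
  proof
    have "continuous_map (prod_topology (top_of_set {0..1}) (subtopology (?E ?M) (?B ?M))) (?E ?N)
        (\<lambda>z j. if j < ?N then G z j else 0)"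
      unfolding continuous_map_componentwise_Euclidean_space
      using continuous_map_polynomial_over_C0[OF G_poly] by blast
    moreover have "(if j < ?N then G z j else 0) = G z j" for z j
      by (simp add: G_def assemble_eq_0)
    ultimately show "continuous_map (prod_topology (top_of_set {0..1}) (subtopology (?E ?M) (?B ?M))) (?E ?N) G"
      by simp
    show "G \<in> topspace (prod_topology (top_of_set {0..1}) (subtopology (?E ?M) (?B ?M))) \<rightarrow> ?S"
      using G_in by auto
  qed
  have G_image: "G ` ({0} \<times> ?B ?M) = ?S"
  proof
    show "G ` ({0} \<times> ?B ?M) \<subseteq> ?S"
      using G_in by auto
    show "?S \<subseteq> G ` ({0} \<times> ?B ?M)"
    proof
      fix s assume s: "s \<in> ?S"
      have "\<forall>i\<in>{..<l}. \<exists>y\<in>?B (m i). H i (0, y) = block n i s"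
      proof
        fix i assume "i \<in> {..<l}"
        then have "block n i s \<in> H i ` ({0} \<times> ?B (m i))"
          using s H(3) by (simp add: block_product_def)
        then show "\<exists>y\<in>?B (m i). H i (0, y) = block n i s"
          by auto
      qed
      then obtain y where y: "\<And>i. i < l \<Longrightarrow> y i \<in> ?B (m i)" "\<And>i. i < l \<Longrightarrow> H i (0, y i) = block n i s"
        by (metis lessThan_iff)
      obtain x where x: "x \<in> ?B ?M" "\<And>i. i < l \<Longrightarrow> folded_block m l i x = y i"
        using folded_blocks_onto_product_of_balls[of l y m] y(1) by blast
      have "G (0, x) = assemble n l (\<lambda>i. block n i s)"
        unfolding G_def by (rule assemble_cong) (simp add: x(2) y(2))
      also have "\<dots> = s"
        using s by (intro assemble_block) (simp add: block_product_def)
      finally show "s \<in> G ` ({0} \<times> ?B ?M)"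
        using x(1) by force
    qed
  qed
  have G_const: "\<exists>a. \<forall>x\<in>?B ?M. G (1, x) = a"
  proof -
    have "\<forall>i\<in>{..<l}. \<exists>a. \<forall>x\<in>?B (m i). H i (1, x) = a"
      using H(4) by simp
    then obtain a where a: "\<forall>i\<in>{..<l}. \<forall>x\<in>?B (m i). H i (1, x) = a i"
      by (rule bchoice[THEN exE])
    have "G (1, x) = assemble n l a" if "x \<in> ?B ?M" for x
      unfolding G_def by (rule assemble_cong) (simp add: a fold_in that)
    then show ?thesis
      by blast
  qed
  have G_interior: "G (t, x) \<in> ?E ?N interior_of ?S" if "t \<in> {0<..<1}" "x \<in> ?B ?M" for t x
  proof -
    let ?U = "block_product n l (\<lambda>i. ?E (n i) interior_of S i)"
    have "?U \<subseteq> ?E ?N interior_of ?S"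
    proof (rule interior_of_maximal)
      show "openin (?E ?N) ?U"
        by (intro openin_block_product openin_interior_of)
      show "?U \<subseteq> ?S"
        using interior_of_subset by (fastforce simp: block_product_def)
    qed
    moreover have "G (t, x) \<in> ?U"
      using that fold_in H(5) by (subst G_iff) (auto simp: image_subset_iff)
    ultimately show ?thesis
      by blast
  qed
  have "(\<lambda>_. 0) \<in> ?B ?M"
    by (simp add: closed_unit_ball_def topspace_Euclidean_space)
  then have "?E ?N interior_of ?S \<noteq> {}"
    using G_interior[of "1/2"] by fastforce
  then have dim: "semialgebraic_dim ?N ?S = ereal (real ?N)"
    by (rule semialgebraic_dim_of_interior)
  have "semialgebraic ?N ?S"
    using assms(3) by (intro semialgebraic_block_product) (simp add: brick_iff_homotopy)
  moreover have "brick_homotopy ?M ?N ?S G"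
    unfolding brick_homotopy_def using G_cont G_poly G_image G_const G_interior by auto
  ultimately show ?thesis
    using dim by (auto simp: brick_iff_homotopy)
qed

end
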